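(* Let $G$ be a finite abelian group and $H=\mathrm{Hom}_{\mathbf{Z}}(G,\mathbf{R}/\mathbf{Z})$. For $g\in G$ define $S_{g}:H\to\mathbf{C}$ by $S_{g}(\phi)=B_{1}(\phi(g))$. Then the space $L^{2}_{\mathrm{odd}}(H)$ of functions $f:H\to\mathbf{C}$ with $f(-\phi)=-f(\phi)$ for all $\phi\in H$ is spanned by the functions $S_{g}$, $g\in G$.
   Context: $H$ is an additive group under pointwise addition. For $x\in\mathbf{R}$, $\{x\}\in[0,1)$ denotes the fractional part of $x$, and $B_1(x)=\{x\}-1/2$ if $x\notin\mathbf{Z}$, $B_1(x)=0$ if $x\in\mathbf{Z}$; for $x+\mathbf{Z}\in\mathbf{R}/\mathbf{Z}$ set $B_1(x+\mathbf{Z})=B_1(x)$. *)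

theory Defs
  imports Complex_Main "HOL-Algebra.Coset" "HOL-Library.Function_Algebras"
begin

definition real_add_group :: "real monoid" where
  "real_add_group = \<lparr>carrier = UNIV, mult = (+), one = 0\<rparr>"

abbreviation real_mod_int :: "real set monoid" where
  "real_mod_int \<equiv> real_add_group Mod \<int>"

definition B1 :: "real \<Rightarrow> real" where
  "B1 x = (if x \<in> \<int> then 0 else frac x - 1 / 2)"

text \<open>\<open>B1\<close> is constant on each coset of \<open>\<int>\<close>, see \<open>B1_mod_rcoset\<close> below.\<close>

definition B1_mod :: "real set \<Rightarrow> real" where
  "B1_mod c = the_elem (B1 ` c)"

text \<open>Homomorphisms are normalised to be \<open>undefined\<close> outside \<open>carrier G\<close>, so that each
  mathematical homomorphism is represented by exactly one HOL function.\<close>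

definition hom_group ::
  "('a, 'm) monoid_scheme \<Rightarrow> ('b, 'n) monoid_scheme \<Rightarrow> ('a \<Rightarrow> 'b) monoid" where
  "hom_group G K =
     \<lparr>carrier = hom G K \<inter> extensional (carrier G),
      mult = (\<lambda>\<phi> \<psi>. \<lambda>g\<in>carrier G. \<phi> g \<otimes>\<^bsub>K\<^esub> \<psi> g),
      one = (\<lambda>g\<in>carrier G. \<one>\<^bsub>K\<^esub>)\<rparr>"

abbreviation dual_group :: "('a, 'm) monoid_scheme \<Rightarrow> ('a \<Rightarrow> real set) monoid" where
  "dual_group G \<equiv> hom_group G real_mod_int"

text \<open>Complex functions on the carrier of a group are represented by their extensions by \<open>0\<close>;
  these form a complex vector space under the pointwise operations.\<close>

definition L2_odd :: "('h, 'm) monoid_scheme \<Rightarrow> ('h \<Rightarrow> complex) set" where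
  "L2_odd H = {f. (\<forall>\<phi>. \<phi> \<notin> carrier H \<longrightarrow> f \<phi> = 0) \<and>
                  (\<forall>\<phi>\<in>carrier H. f (inv\<^bsub>H\<^esub> \<phi>) = - f \<phi>)}"

definition S_fun :: "('a, 'm) monoid_scheme \<Rightarrow> 'a \<Rightarrow> ('a \<Rightarrow> real set) \<Rightarrow> complex" where
  "S_fun G g = (\<lambda>\<phi>. if \<phi> \<in> carrier (dual_group G) then complex_of_real (B1_mod (\<phi> g)) else 0)"

definition fun_scale :: "complex \<Rightarrow> ('h \<Rightarrow> complex) \<Rightarrow> 'h \<Rightarrow> complex" where
  "fun_scale c f = (\<lambda>\<phi>. c * f \<phi>)"

lemma vector_space_fun_scale: "vector_space fun_scale"
  by unfold_locales (auto simp: fun_scale_def fun_eq_iff algebra_simps)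

lemma subspace_L2_odd: "module.subspace fun_scale (L2_odd H)"
proof -
  interpret vector_space "fun_scale :: complex \<Rightarrow> ('a \<Rightarrow> complex) \<Rightarrow> _"
    by (rule vector_space_fun_scale)
  show ?thesis
    by (rule subspaceI) (auto simp: L2_odd_def fun_scale_def)
qed

lemma comm_group_real_add_group: "comm_group real_add_group"
  by (rule comm_groupI) (auto simp: real_add_group_def intro: exI[of _ "- x" for x])

lemma inv_real_add_group: "inv\<^bsub>real_add_group\<^esub> x = - x"
proof -
  interpret comm_group real_add_group by (rule comm_group_real_add_group)
  show ?thesis by (rule inv_equality) (auto simp: real_add_group_def)
qed

lemma subgroup_Ints: "subgroup \<int> real_add_group"
proof
  show "inv\<^bsub>real_add_group\<^esub> x \<in> \<int>" if "x \<in> \<int>" for x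
    using that by (simp add: inv_real_add_group)
qed (auto simp: real_add_group_def)

lemma comm_group_real_mod_int: "comm_group real_mod_int"
  using comm_group.abelian_FactGroup[OF comm_group_real_add_group subgroup_Ints] .

lemma B1_add_int: "n \<in> \<int> \<Longrightarrow> B1 (n + x) = B1 x"
  by (auto simp: B1_def frac_def elim!: Ints_cases)

lemma B1_mod_rcoset: "B1_mod (\<int> #>\<^bsub>real_add_group\<^esub> x) = B1 x"
proof -
  have "B1 ` (\<int> #>\<^bsub>real_add_group\<^esub> x) = {B1 x}"
    by (force simp: r_coset_def real_add_group_def B1_add_int intro: image_eqI[of _ _ x] bexI[of _ 0])
  then show ?thesis by (simp add: B1_mod_def)
qed

lemma comm_group_hom_group:
  assumes "group G" and "comm_group K"
  shows "comm_group (hom_group G K)"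
proof -
  interpret G: group G by fact
  interpret K: comm_group K by fact
  show ?thesis
  proof (rule comm_groupI, goal_cases)
    case (6 \<phi>)
    then have \<phi>: "\<phi> \<in> hom G K" "\<phi> \<in> extensional (carrier G)" by (auto simp: hom_group_def)
    define \<psi> where "\<psi> = (\<lambda>g\<in>carrier G. inv\<^bsub>K\<^esub> \<phi> g)"
    have cl: "\<And>g. g \<in> carrier G \<Longrightarrow> \<phi> g \<in> carrier K" using \<phi> by (auto simp: hom_def)
    have "\<psi> \<in> carrier (hom_group G K)"
      using \<phi> cl by (auto simp: hom_group_def \<psi>_def hom_def K.inv_mult)
    moreover have "\<psi> \<otimes>\<^bsub>hom_group G K\<^esub> \<phi> = \<one>\<^bsub>hom_group G K\<^esub>"
      using cl by (auto simp: hom_group_def \<psi>_def fun_eq_iff)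
    ultimately show ?case by blast
  qed (auto simp: hom_group_def hom_def Pi_def K.m_ac fun_eq_iff extensional_def restrict_def)
qed

lemma inv_hom_group:
  assumes "group G" and "comm_group K" and \<phi>: "\<phi> \<in> carrier (hom_group G K)"
  shows "inv\<^bsub>hom_group G K\<^esub> \<phi> = (\<lambda>g\<in>carrier G. inv\<^bsub>K\<^esub> \<phi> g)"
proof -
  interpret G: group G by fact
  interpret K: comm_group K by fact
  interpret H: comm_group "hom_group G K" by (rule comm_group_hom_group) fact+
  have cl: "\<And>g. g \<in> carrier G \<Longrightarrow> \<phi> g \<in> carrier K" using \<phi> by (auto simp: hom_group_def hom_def)
  have "(\<lambda>g\<in>carrier G. inv\<^bsub>K\<^esub> \<phi> g) \<in> carrier (hom_group G K)"
    using \<phi> cl by (auto simp: hom_group_def hom_def K.inv_mult)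
  moreover have "(\<lambda>g\<in>carrier G. inv\<^bsub>K\<^esub> \<phi> g) \<otimes>\<^bsub>hom_group G K\<^esub> \<phi> = \<one>\<^bsub>hom_group G K\<^esub>"
    using cl by (auto simp: hom_group_def fun_eq_iff)
  ultimately show ?thesis using H.inv_equality \<phi> by blast
qed

end

theory Submission
  imports Defs "HOL-Analysis.Analysis" "HOL-Number_Theory.Residues"
    "HOL-Computational_Algebra.Nth_Powers" "HOL-Computational_Algebra.Fundamental_Theorem_Algebra"
begin

text \<open>
  If the \<open>S_g\<close> do not span, some nonzero odd function \<open>l\<close> on the dual group annihilates all of them.
  By the Fourier series of \<open>B_1\<close>, its Fourier transform \<open>a(g) = \<Sum>\<phi>. l(\<phi>) e(\<phi>(g))\<close> satisfies
  \<open>\<Sum>n. a(n g)/n = 0\<close> for every \<open>g\<close>. For fixed \<open>g\<close>, the odd periodic sequences \<open>b\<close> with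
  \<open>\<Sum>n. b(m n)/n = 0\<close> for all \<open>m\<close> form a space stable under the commuting dilations
  \<open>b \<mapsto> b(k \<cdot>)\<close>. A common eigenvector in it is a multiple of a completely multiplicative, odd,
  periodic \<open>h\<close> with \<open>L(1, h) = 0\<close>, which is impossible: for real \<open>h\<close> by Monsky's Lambert series
  argument, for complex \<open>h\<close> by the inequality \<open>1 \<le> \<zeta>(s)^3 |L(s, h)|^4 |L(s, h^2)|\<close> as \<open>s\<close> tends
  to \<open>1\<close>. So \<open>a = 0\<close>, and \<open>l = 0\<close> by orthogonality of characters.
\<close>

section \<open>Series with bounded partial sums and the Fourier series of \<open>B1\<close>\<close>

text \<open>Expansion in Dirichlet characters is awkward because a dilation by \<open>k\<close>
  sharing a factor with the modulus is not invertible. A common eigenvector treats all residues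
  alike: its eigenvalues, some possibly 0, already form a completely multiplicative function.
  Oddness makes its sum over a period vanish, which bounds the partial sums and gives access to Abel
  summation. The split into real and complex \<open>h\<close> is forced by \<open>h^2\<close>. At
  \<open>s = 1 + \<delta>\<close> a zero at 1 gives \<open>L(s, h) = O(\<delta>)\<close>, and
  \<open>zeta(s) = O(1/\<delta>)\<close>, so the right-hand side of the inequality is
  \<open>O(\<delta>) |L(s, h^2)|\<close>. For complex \<open>h\<close> the last factor stays
  bounded, a contradiction for small \<open>\<delta>\<close>; for real \<open>h\<close> it grows
  like \<open>1/\<delta>\<close> and the inequality yields nothing. Everything takes place at real
  \<open>s > 1\<close> with explicit bounds.\<close>

text \<open>Abel summation leaves a series dominated by \<open>C\<close> times the variation of
  \<open>b\<close>. Bounded variation instead of monotonicity is meant for the weights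
  \<open>1/n - n powr -(1 + \<delta>)\<close> of \<open>L_near_one\<close>, which start at 0, rise
  and then decay.\<close>

lemma bounded_variation_test:
  fixes a :: "nat \<Rightarrow> 'a :: {real_normed_field, banach}" and b :: "nat \<Rightarrow> real"
  assumes bnd: "\<And>n. norm (\<Sum>k<n. a k) \<le> C"
    and bv: "summable (\<lambda>n. \<bar>b n - b (Suc n)\<bar>)" and lim: "b \<longlonglongrightarrow> 0"
  shows "summable (\<lambda>n. a n * of_real (b n))"
    and "norm (\<Sum>n. a n * of_real (b n)) \<le> C * (\<Sum>n. \<bar>b n - b (Suc n)\<bar>)"
proof -
  define A where "A n = (\<Sum>k<n. a k)" for n
  have nA: "norm (A n) \<le> C" for n using bnd by (simp add: A_def)
  have parts: "(\<Sum>k<n. a k * of_real (b k)) =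
      (\<Sum>k<n. A (Suc k) * of_real (b k - b (Suc k))) + A n * of_real (b n)" for n
    by (induction n) (auto simp: A_def algebra_simps)
  have le: "norm (A (Suc k) * of_real (b k - b (Suc k))) \<le> C * \<bar>b k - b (Suc k)\<bar>" for k
    using nA[of "Suc k"] by (simp add: norm_mult mult_right_mono del: of_real_diff)
  have sC: "summable (\<lambda>k. C * \<bar>b k - b (Suc k)\<bar>)"
    using bv by (rule summable_mult)
  have s1: "summable (\<lambda>k. A (Suc k) * of_real (b k - b (Suc k)))"
    using le by (intro summable_comparison_test'[OF sC]) auto
  have "(\<lambda>n. A n * of_real (b n)) \<longlonglongrightarrow> 0"
  proof (rule Lim_null_comparison)
    show "\<forall>\<^sub>F n in sequentially. norm (A n * of_real (b n)) \<le> C * \<bar>b n\<bar>"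
      using nA by (intro always_eventually allI) (simp add: norm_mult mult_right_mono)
    show "(\<lambda>n. C * \<bar>b n\<bar>) \<longlonglongrightarrow> 0"
      using tendsto_mult[OF tendsto_const tendsto_rabs[OF lim]] by simp
  qed
  from tendsto_add[OF summable_LIMSEQ[OF s1] this]
  have sums: "(\<lambda>n. a n * of_real (b n)) sums (\<Sum>k. A (Suc k) * of_real (b k - b (Suc k)))"
    by (simp add: sums_def parts)
  then show "summable (\<lambda>n. a n * of_real (b n))" by (rule sums_summable)
  have "norm (\<Sum>k. A (Suc k) * of_real (b k - b (Suc k))) \<le> (\<Sum>k. C * \<bar>b k - b (Suc k)\<bar>)"
    by (rule norm_suminf_le[OF le sC])
  with sums show "norm (\<Sum>n. a n * of_real (b n)) \<le> C * (\<Sum>n. \<bar>b n - b (Suc n)\<bar>)"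
    using suminf_mult[OF bv, of C] by (simp add: sums_iff)
qed

lemma Dirichlet_test:
  fixes a :: "nat \<Rightarrow> 'a :: {real_normed_field, banach}" and b :: "nat \<Rightarrow> real"
  assumes bnd: "\<And>n. norm (\<Sum>k<n. a k) \<le> C"
    and dec: "\<And>n. b (Suc n) \<le> b n" and lim: "b \<longlonglongrightarrow> 0"
  shows "summable (\<lambda>n. a n * of_real (b n))"
    and "norm (\<Sum>n. a n * of_real (b n)) \<le> C * b 0"
proof -
  have "(\<lambda>n. \<bar>b n - b (Suc n)\<bar>) sums b 0"
    using telescope_sums'[OF lim] dec by simp
  with bounded_variation_test[OF bnd _ lim]
  show "summable (\<lambda>n. a n * of_real (b n))"
    and "norm (\<Sum>n. a n * of_real (b n)) \<le> C * b 0"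
    by (auto simp: sums_iff)
qed

lemma inverse_Suc_tendsto_0: "(\<lambda>n. 1 / real (Suc n)) \<longlonglongrightarrow> 0"
  using LIMSEQ_inverse_real_of_nat by (simp add: inverse_eq_divide)

text \<open>Geometric sums are bounded, so the series converges conditionally; its value is a radial
  limit (Abel's theorem in quantitative form). \<open>Ln\<close> is continuous there since a point
  of the unit circle with real part at least 1 equals 1.\<close>

lemma log_series_on_circle:
  fixes z :: complex
  assumes z: "norm z = 1" "z \<noteq> 1"
  shows "(\<lambda>n. z ^ Suc n / of_nat (Suc n)) sums (- Ln (1 - z))"
proof -
  define C where "C = 2 / norm (1 - z)"
  have bnd: "norm (\<Sum>k<n. z ^ Suc k) \<le> C" for n
  proof -
    have "(\<Sum>k<n. z ^ Suc k) = z * ((1 - z ^ n) / (1 - z))"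
      using z by (simp add: sum_distrib_left[symmetric] sum_gp_strict)
    moreover have "norm (1 - z ^ n) \<le> 2"
      using norm_triangle_ineq4[of 1 "z ^ n"] z by (simp add: norm_power)
    ultimately show ?thesis
      using z by (simp add: C_def norm_mult norm_divide divide_right_mono)
  qed
  have sm: "summable (\<lambda>n. z ^ Suc n * of_real (1 / real (Suc n)))"
    by (rule Dirichlet_test(1)[OF bnd _ inverse_Suc_tendsto_0]) (simp add: field_simps)
  define S where "S = (\<Sum>n. z ^ Suc n * of_real (1 / real (Suc n)))"
  \<comment> \<open>Abel summation with the weights \<open>(1 - r ^ n) / n\<close>, which decrease from \<open>1 - r\<close> to \<open>0\<close>.\<close>
  have close: "norm (S + Ln (1 - of_real r * z)) \<le> C * (1 - r)" if r: "0 \<le> r" "r < 1" for r :: real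
  proof -
    define b where "b n = (1 - r ^ Suc n) / real (Suc n)" for n
    have dec: "b (Suc n) \<le> b n" for n
    proof -
      \<comment> \<open>Cross-multiplied, \<open>b (Suc n) \<le> b n\<close> says
        \<open>(n+1) r^(n+1) (1-r) \<le> 1 - r^(n+1)\<close>; each of the \<open>n+1\<close> terms
        of the geometric sum is at least \<open>r^(n+1)\<close>.\<close>
      have "real (Suc n) * r ^ Suc n \<le> (\<Sum>k<Suc n. r ^ k)"
        using sum_bounded_below[of "{..<Suc n}" "r ^ Suc n" "\<lambda>k. r ^ k"] r
        by (simp add: power_decreasing del: power_Suc sum.lessThan_Suc)
      then have "real (Suc n) * r ^ Suc n * (1 - r) \<le> (\<Sum>k<Suc n. r ^ k) * (1 - r)"
        using r by (intro mult_right_mono) auto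
      also have "\<dots> = 1 - r ^ Suc n"
        using r by (subst sum_gp_strict) auto
      finally show ?thesis
        unfolding b_def by (simp add: field_simps)
    qed
    have lim: "b \<longlonglongrightarrow> 0"
    proof (rule Lim_null_comparison[OF _ inverse_Suc_tendsto_0], intro always_eventually allI)
      fix n
      have "r ^ Suc n \<le> 1" "0 \<le> r ^ Suc n" using r by (auto intro!: power_le_one simp del: power_Suc)
      then show "norm (b n) \<le> 1 / real (Suc n)"
        unfolding b_def by (simp add: divide_right_mono del: power_Suc)
    qed
    have "(\<lambda>n. - ((of_real r * z) ^ n) / of_nat n) sums Ln (1 - of_real r * z)"
      using Ln_series'[of "- (of_real r * z)"] r z by (simp add: norm_mult)
    then have "(\<lambda>n. - ((of_real r * z) ^ Suc n) / of_nat (Suc n)) sums Ln (1 - of_real r * z)"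
      by (subst sums_Suc_iff) simp
    from sums_add[OF summable_sums[OF sm] this]
    have "(\<lambda>n. z ^ Suc n * of_real (b n)) sums (S + Ln (1 - of_real r * z))"
      by (simp add: S_def b_def power_mult_distrib divide_simps algebra_simps del: power_Suc of_nat_Suc)
    with Dirichlet_test(2)[OF bnd dec lim] show ?thesis
      by (simp add: sums_iff b_def)
  qed
  have "1 - z \<notin> \<real>\<^sub>\<le>\<^sub>0"
  proof
    assume "1 - z \<in> \<real>\<^sub>\<le>\<^sub>0"
    then have im: "Im z = 0" and re: "Re z \<ge> 1" by (auto simp: complex_nonpos_Reals_iff)
    from im z(1) have "\<bar>Re z\<bar> = 1" by (simp add: cmod_eq_Re)
    with re im z(2) show False by (auto simp: complex_eq_iff)
  qed
  then have "((\<lambda>r. S + Ln (1 - of_real r * z)) \<longlongrightarrow> S + Ln (1 - of_real 1 * z)) (at_left 1)"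
    by (intro tendsto_intros) auto
  moreover have "((\<lambda>r. S + Ln (1 - of_real r * z)) \<longlongrightarrow> 0) (at_left 1)"
  proof (rule Lim_null_comparison)
    show "\<forall>\<^sub>F r in at_left 1. norm (S + Ln (1 - of_real r * z)) \<le> C * (1 - r)"
      using eventually_at_left_real[OF zero_less_one] by eventually_elim (use close in auto)
    have "((\<lambda>r. C * (1 - r)) \<longlongrightarrow> C * (1 - 1)) (at_left (1::real))"
      by (intro tendsto_intros)
    then show "((\<lambda>r. C * (1 - r)) \<longlongrightarrow> 0) (at_left (1::real))" by simp
  qed
  ultimately have "S + Ln (1 - z) = 0"
    using tendsto_unique[OF trivial_limit_at_left_real] by fastforce
  then have "S = - Ln (1 - z)" by (simp add: add_eq_0_iff2)
  with summable_sums[OF sm] show ?thesis by (simp add: S_def)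
qed

text \<open>The polar form
  \<open>1 - cis \<theta> = 2 sin(\<theta>/2) cis((\<theta> - pi)/2)\<close> shows the argument,
  which is principal for \<open>0 < \<theta> < 2 pi\<close>. At integers every term vanishes,
  matching the value 0 of \<open>B1\<close>.\<close>

lemma B1_Fourier_series:
  "(\<lambda>n. Im (cis (2 * pi * x) ^ Suc n) / real (Suc n)) sums (- pi * B1 x)"
proof (cases "x \<in> \<int>")
  case True
  then have "cis (2 * pi * x) = 1"
    by (auto elim!: Ints_cases simp: cis_multiple_2pi)
  with True show ?thesis by (simp add: B1_def)
next
  case False
  define \<theta> where "\<theta> = 2 * pi * frac x"
  have th: "0 < \<theta>" "\<theta> < 2 * pi"
    using False frac_lt_1[of x] frac_gt_0_iff[of x] by (auto simp: \<theta>_def)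
  have cis: "cis (2 * pi * x) = cis \<theta>"
  proof -
    have "2 * pi * x = \<theta> + 2 * pi * of_int \<lfloor>x\<rfloor>" by (simp add: \<theta>_def frac_def algebra_simps)
    then show ?thesis by (simp add: cis_mult[symmetric] cis_multiple_2pi)
  qed
  have s: "sin (\<theta> / 2) > 0" using th by (intro sin_gt_zero) auto
  have eq: "1 - cis \<theta> = of_real (2 * sin (\<theta> / 2)) * cis ((\<theta> - pi) / 2)"
  proof -
    have "cos \<theta> = 1 - 2 * sin (\<theta> / 2) ^ 2" using cos_double_sin[of "\<theta> / 2"] by simp
    moreover have "sin \<theta> = 2 * sin (\<theta> / 2) * cos (\<theta> / 2)" using sin_double[of "\<theta> / 2"] by simp
    ultimately show ?thesis
      by (simp add: complex_eq_iff diff_divide_distrib cos_diff sin_diff power2_eq_square)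
  qed
  have "1 - cis \<theta> = exp (of_real (ln (2 * sin (\<theta> / 2))) + \<i> * of_real ((\<theta> - pi) / 2))"
    unfolding exp_add eq by (subst exp_of_real) (use s in \<open>simp add: cis_conv_exp\<close>)
  then have "Ln (1 - cis \<theta>) = of_real (ln (2 * sin (\<theta> / 2))) + \<i> * of_real ((\<theta> - pi) / 2)"
    by (simp only:) (rule Ln_exp, use th in auto)
  then have "Im (Ln (1 - cis \<theta>)) = (\<theta> - pi) / 2" by simp
  moreover have "cis \<theta> \<noteq> 1" using eq s by (auto simp: cis_neq_zero)
  then have "(\<lambda>n. Im (cis \<theta> ^ Suc n / of_nat (Suc n))) sums Im (- Ln (1 - cis \<theta>))"
    by (intro sums_Im log_series_on_circle) auto
  moreover have "Im (w / of_nat n) = Im w / real n" for w n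
    by (metis Im_divide_of_real of_real_of_nat_eq)
  ultimately have "(\<lambda>n. Im (cis \<theta> ^ Suc n) / real (Suc n)) sums (- ((\<theta> - pi) / 2))"
    by (simp only: uminus_complex.simps)
  moreover have "- ((\<theta> - pi) / 2) = - pi * B1 x"
    using False by (simp add: B1_def \<theta>_def field_simps)
  ultimately show ?thesis by (simp only: cis)
qed

section \<open>Nonvanishing for real characters\<close>

text \<open>Reflecting both index ranges pairs the \<open>n(n+1)\<close> powers
  \<open>t^(i+j)\<close> so that exponents add up to \<open>2n - 1\<close>; by the
  arithmetic-geometric mean inequality each pair contributes at least \<open>2 t^n\<close>. This is
  the core of \<open>Lambert_weight_decreasing\<close>.\<close>

lemma sum_powers_product_ge:
  fixes t :: real
  assumes "0 \<le> t" "t \<le> 1"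
  shows "real n * real (Suc n) * t ^ n \<le> (\<Sum>i<n. t ^ i) * (\<Sum>i<Suc n. t ^ i)"
proof -
  define f where "f i j = t ^ (i + j)" for i j :: nat
  define P where "P = (\<Sum>i<n. \<Sum>j<Suc n. f i j)"
  have prod: "(\<Sum>i<n. t ^ i) * (\<Sum>i<Suc n. t ^ i) = P"
    by (simp only: P_def f_def sum_product power_add)
  have rev: "(\<Sum>j<Suc n. g j) = (\<Sum>j<Suc n. g (n - j))" for g :: "nat \<Rightarrow> real"
    using sum.nat_diff_reindex[of g "Suc n"] by simp
  have "P = (\<Sum>i<n. \<Sum>j<Suc n. f (n - Suc i) j)"
    unfolding P_def by (rule sum.nat_diff_reindex[symmetric])
  also have "\<dots> = (\<Sum>i<n. \<Sum>j<Suc n. f (n - Suc i) (n - j))"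
    by (intro sum.cong refl rev)
  finally have "P = (\<Sum>i<n. \<Sum>j<Suc n. f (n - Suc i) (n - j))" .
  then have "2 * P = (\<Sum>i<n. \<Sum>j<Suc n. f i j + f (n - Suc i) (n - j))"
    by (simp add: P_def sum.distrib del: sum.lessThan_Suc)
  also have "\<dots> \<ge> (\<Sum>i<n. \<Sum>j<Suc n. 2 * t ^ n)"
  proof (intro sum_mono)
    fix i j assume ij: "i \<in> {..<n}" "j \<in> {..<Suc n}"
    \<comment> \<open>Comparing with \<open>2n\<close> instead of \<open>2n - 1\<close> avoids
      half-integral powers: \<open>t^k + t^(2n-k) - 2 t^n\<close> is \<open>t^k\<close> times a
      square, and \<open>t^(2n-k) \<le> t^l\<close>. Of two paired exponents one is at most
      \<open>n\<close>.\<close>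
    have amgm: "2 * t ^ n \<le> t ^ k + t ^ l" if "k + l \<le> 2 * n" "k \<le> n" for k l
    proof -
      have "0 \<le> t ^ k * (1 - t ^ (n - k)) ^ 2" using assms by simp
      also have "\<dots> = t ^ k + t ^ (2 * n - k) - 2 * t ^ n"
      proof -
        have "t ^ n = t ^ k * t ^ (n - k)" "t ^ (2 * n - k) = t ^ k * t ^ (n - k) * t ^ (n - k)"
          using that by (simp_all add: power_add[symmetric] mult_2)
        then show ?thesis by (simp add: power2_eq_square algebra_simps)
      qed
      also have "t ^ (2 * n - k) \<le> t ^ l" using assms that by (intro power_decreasing) auto
      finally show ?thesis by simp
    qed
    show "2 * t ^ n \<le> f i j + f (n - Suc i) (n - j)"
      using ij amgm[of "i + j" "n - Suc i + (n - j)"] amgm[of "n - Suc i + (n - j)" "i + j"]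
      by (cases "i + j \<le> n") (auto simp: f_def add.commute)
  qed
  finally show ?thesis unfolding prod by (simp add: algebra_simps)
qed

lemma sum_divisors_coprime_mult:
  fixes f :: "nat \<Rightarrow> 'a :: comm_semiring_1"
  assumes "coprime a b" and f: "\<And>m n. f (m * n) = f m * f n"
  shows "(\<Sum>d | d dvd a * b. f d) = (\<Sum>d | d dvd a. f d) * (\<Sum>d | d dvd b. f d)"
proof -
  have "bij_betw (\<lambda>(x, y). x * y) ({d. d dvd a} \<times> {d. d dvd b}) {d. d dvd a * b}"
    unfolding bij_betw_def
  proof
    have co: "coprime x y" if "x dvd a" "y dvd b" for x y
      using assms(1) that coprime_divisors by blast
    show "inj_on (\<lambda>(x, y). x * y) ({d. d dvd a} \<times> {d. d dvd b})"
    proof (rule inj_onI, clarsimp)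
      fix x y x' y' assume *: "x dvd a" "y dvd b" "x' dvd a" "y' dvd b" "x * y = x' * y'"
      then have "x dvd x'" "x' dvd x" "y dvd y'" "y' dvd y"
        using co by (metis coprime_dvd_mult_left_iff coprime_dvd_mult_right_iff coprime_commute dvd_triv_left dvd_triv_right)+
      then show "x = x' \<and> y = y'" by (simp add: dvd_antisym)
    qed
    show "(\<lambda>(x, y). x * y) ` ({d. d dvd a} \<times> {d. d dvd b}) = {d. d dvd a * b}"
      using division_decomp[of _ a b] by (fastforce intro: mult_dvd_mono)
  qed
  then have "(\<Sum>d | d dvd a * b. f d) = (\<Sum>(x, y) \<in> {d. d dvd a} \<times> {d. d dvd b}. f (x * y))"
    by (subst sum.reindex_bij_betw[symmetric]) (auto simp: case_prod_unfold)
  then show ?thesis by (simp add: f sum_product sum.cartesian_product)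
qed

text \<open>Splitting off a full prime power multiplies the divisor sum by
  \<open>1 + h p + ... + h p ^ k\<close>, which is \<open>k + 1\<close>, 1, or an alternating sum
  equal to 0 or 1. It is at least 1 for even \<open>k\<close>, and all exponents of a square are
  even.\<close>

lemma divisor_sum_real_character:
  fixes h :: "nat \<Rightarrow> real"
  assumes mult: "\<And>m n. h (m * n) = h m * h n" and one: "h 1 = 1"
    and val: "\<And>n. h n \<in> {-1, 0, 1}" and "n > 0"
  shows "0 \<le> (\<Sum>d | d dvd n. h d) \<and> (is_square n \<longrightarrow> 1 \<le> (\<Sum>d | d dvd n. h d))"
  using \<open>n > 0\<close>
proof (induction n rule: less_induct)
  case (less n)
  show ?case
  proof (cases "n = 1")
    case True
    then show ?thesis by (simp add: one[simplified])
  next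
    case False
    then obtain p where p: "prime p" "p dvd n" using prime_factor_nat by blast
    define k where "k = multiplicity p n"
    obtain m where m: "n = p ^ k * m" "\<not> p dvd m"
      using multiplicity_decompose'[of n p] less.prems p unfolding k_def
      by (metis not_prime_unit gr_implies_not0)
    have "m > 0" using m(2) by (cases m) auto
    have "k > 0" using less.prems p by (simp add: k_def prime_multiplicity_gt_zero_iff)
    have "p ^ k > 1" using prime_gt_1_nat[OF p(1)] \<open>k > 0\<close> by (rule one_less_power)
    then have "m < n" using m \<open>m > 0\<close> by simp
    have co: "coprime (p ^ k) m" using p m by (simp add: prime_imp_coprime)
    have pk: "(\<Sum>d | d dvd p ^ k. h d) = (\<Sum>i\<le>k. h p ^ i)"
    proof -
      have "{d. d dvd p ^ k} = (\<lambda>i. p ^ i) ` {..k}"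
        using divides_primepow_nat[OF p(1)] by auto
      moreover have "inj_on (\<lambda>i. p ^ i) {..k}"
        using p prime_gt_1_nat by (auto intro!: inj_onI simp: power_inject_exp)
      moreover have "h (p ^ i) = h p ^ i" for i by (induction i) (simp_all add: one[simplified] mult)
      ultimately show ?thesis by (simp add: sum.reindex)
    qed
    have alt: "(\<Sum>i\<le>j. (-1::real) ^ i) = (if even j then 1 else 0)" for j by (induction j) auto
    have zero: "(\<Sum>i\<le>j. (0::real) ^ i) = 1" for j by (induction j) auto
    have ge: "0 \<le> (\<Sum>i\<le>k. h p ^ i)" "even k \<Longrightarrow> 1 \<le> (\<Sum>i\<le>k. h p ^ i)"
      using val[of p] by (auto simp: alt zero)
    have IH: "0 \<le> (\<Sum>d | d dvd m. h d)" "is_square m \<Longrightarrow> 1 \<le> (\<Sum>d | d dvd m. h d)"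
      using less.IH[OF \<open>m < n\<close> \<open>m > 0\<close>] by auto
    have eq: "(\<Sum>d | d dvd n. h d) = (\<Sum>i\<le>k. h p ^ i) * (\<Sum>d | d dvd m. h d)"
      unfolding m(1) sum_divisors_coprime_mult[OF co mult] pk ..
    have "1 \<le> (\<Sum>i\<le>k. h p ^ i) * (\<Sum>d | d dvd m. h d)" if sq: "is_square n"
    proof -
      have "is_square (p ^ k) \<and> is_square m"
        using sq is_nth_power_mult_coprime_natD[OF co, of 2] m(1) less.prems by simp
      moreover have "even k"
      proof -
        from sq obtain r where "n = r ^ 2" by (auto simp: is_nth_power_def)
        then show ?thesis using less.prems p by (auto simp: k_def prime_elem_multiplicity_power_distrib)
      qed
      ultimately show ?thesis using ge(2) IH(2) mult_mono[of 1 _ 1] by fastforce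
    qed
    with ge(1) IH(1) show ?thesis unfolding eq by simp
  qed
qed

lemma has_sum_Suc_iff:
  "((\<lambda>n. f (Suc n)) has_sum S) UNIV \<longleftrightarrow> (f has_sum S) {1..}"
  by (rule has_sum_reindex_bij_betw) (auto simp: bij_betw_def image_iff Suc_le_eq gr0_conv_Suc)

text \<open>Expand each fraction into a geometric series and collect the terms with
  \<open>n * k = m\<close>. Both forms are kept with a common \<open>S\<close>: the first suits Abel
  summation, the second comparison with finite partial sums.\<close>

lemma Lambert_series_has_sum:
  fixes h :: "nat \<Rightarrow> real" and t :: real
  assumes h: "\<And>n. \<bar>h n\<bar> \<le> 1" and t: "0 < t" "t < 1"
  obtains S where "(\<lambda>n. h (Suc n) * (t ^ Suc n / (1 - t ^ Suc n))) sums S"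
    and "((\<lambda>m. (\<Sum>d | d dvd m. h d) * t ^ m) has_sum S) {1..}"
proof -
  have geo: "((\<lambda>k. c * t ^ (n * k)) has_sum c * (t ^ n / (1 - t ^ n))) {1..}" if "n \<ge> 1" for n c
  proof -
    have q: "0 \<le> t ^ n" "t ^ n < 1" using t that by (auto simp: power_less_one_iff)
    have "(\<lambda>k. (t ^ n) ^ Suc k) sums (t ^ n * (1 / (1 - t ^ n)))"
      using sums_mult[OF geometric_sums[of "t ^ n"], of "t ^ n"] q by simp
    then have "((\<lambda>k. t ^ (n * Suc k)) has_sum (t ^ n / (1 - t ^ n))) UNIV"
      by (intro sums_nonneg_imp_has_sum) (use t in \<open>simp_all add: power_mult power_add\<close>)
    then show ?thesis
      unfolding has_sum_Suc_iff[of "\<lambda>k. t ^ (n * k)"] by (rule has_sum_cmult_right)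
  qed
  have bnd: "norm (\<bar>h (Suc n)\<bar> * (t ^ Suc n / (1 - t ^ Suc n))) \<le> t ^ Suc n * (1 / (1 - t))" for n
  proof -
    have "t ^ Suc n \<le> t ^ 1" using t by (intro power_decreasing) auto
    then have "1 / (1 - t ^ Suc n) \<le> 1 / (1 - t)" using t by (intro divide_left_mono) (auto simp del: power_Suc)
    then have "t ^ Suc n * (1 / (1 - t ^ Suc n)) \<le> t ^ Suc n * (1 / (1 - t))"
      using t by (intro mult_left_mono) auto
    moreover have "0 \<le> t ^ Suc n / (1 - t ^ Suc n)"
      using t \<open>t ^ Suc n \<le> t ^ 1\<close> by (intro divide_nonneg_nonneg) (auto simp del: power_Suc)
    ultimately show ?thesis
      using mult_mono[OF h[of "Suc n"] order.refl, of "t ^ Suc n / (1 - t ^ Suc n)"]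
      unfolding real_norm_def abs_mult abs_idempotent by (simp only: abs_of_nonneg) simp
  qed
  have "summable (\<lambda>n. t ^ Suc n * (1 / (1 - t)))"
    using t by (intro summable_mult2) (subst summable_Suc_iff, auto intro: summable_geometric)
  then have sm: "summable (\<lambda>n. norm (\<bar>h (Suc n)\<bar> * (t ^ Suc n / (1 - t ^ Suc n))))"
    by (rule summable_comparison_test'[of _ 0]) (use bnd in \<open>simp only: real_norm_def abs_idempotent\<close>)
  then have sm': "summable (\<lambda>n. norm (h (Suc n) * (t ^ Suc n / (1 - t ^ Suc n))))"
    by (simp only: real_norm_def abs_mult abs_idempotent)
  define S where "S = (\<Sum>n. h (Suc n) * (t ^ Suc n / (1 - t ^ Suc n)))"
  have sums: "(\<lambda>n. h (Suc n) * (t ^ Suc n / (1 - t ^ Suc n))) sums S"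
    unfolding S_def by (rule summable_sums[OF summable_norm_cancel[OF sm']])
  define F where "F = (\<lambda>(n, k). h n * t ^ (n * k))"
  have "(\<lambda>x. norm (F x)) summable_on ({1..} \<times> {1..})"
  proof (rule summable_on_SigmaI)
    show "((\<lambda>k. norm (F (n, k))) has_sum \<bar>h n\<bar> * (t ^ n / (1 - t ^ n))) {1..}" if "n \<in> {1..}" for n
      using geo[of n "\<bar>h n\<bar>"] that t by (simp add: F_def abs_mult)
    show "(\<lambda>n. \<bar>h n\<bar> * (t ^ n / (1 - t ^ n))) summable_on {1..}"
      using norm_summable_imp_has_sum[OF sm summable_sums[OF summable_norm_cancel[OF sm]]]
      unfolding has_sum_Suc_iff[of "\<lambda>n. \<bar>h n\<bar> * (t ^ n / (1 - t ^ n))"]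
      by (rule has_sum_imp_summable)
  qed auto
  then have "F summable_on ({1..} \<times> {1..})" by (rule abs_summable_summable)
  then have "(F has_sum S) ({1..} \<times> {1..})"
  proof (rule has_sum_SigmaI[rotated 2])
    show "((\<lambda>k. F (n, k)) has_sum h n * (t ^ n / (1 - t ^ n))) {1..}" if "n \<in> {1..}" for n
      using geo[of n "h n"] that by (simp add: F_def)
    show "((\<lambda>n. h n * (t ^ n / (1 - t ^ n))) has_sum S) {1..}"
      using norm_summable_imp_has_sum[OF sm' sums]
      unfolding has_sum_Suc_iff[of "\<lambda>n. h n * (t ^ n / (1 - t ^ n))"] .
  qed
  also have "(F has_sum S) ({1..} \<times> {1..}) \<longleftrightarrow>
      ((\<lambda>(m, d). h d * t ^ m) has_sum S) (Sigma {1..} (\<lambda>m. {d. d dvd m}))"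
    by (rule has_sum_reindex_bij_witness[of _ "\<lambda>(m, d). (d, m div d)" "\<lambda>(n, k). (n * k, n)"])
       (auto simp: F_def dvd_div_ge_1 Suc_le_eq dvd_pos_nat dvd_div_eq_0_iff intro!: Nat.gr0I)
  finally have "((\<lambda>m. \<Sum>d | d dvd m. h d * t ^ m) has_sum S) {1..}"
    by (rule has_sum_SigmaD) (auto intro!: has_sum_finite)
  then have "((\<lambda>m. (\<Sum>d | d dvd m. h d) * t ^ m) has_sum S) {1..}"
    by (simp add: sum_distrib_right)
  with sums that show thesis by blast
qed

text \<open>With \<open>A = 1 + ... + t^(n-1)\<close> and \<open>B = 1 + t A\<close>, factoring out
  \<open>1 - t\<close> reduces the claim to \<open>t^n / (A B) \<le> 1/n - 1/(n+1)\<close>, which is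
  \<open>sum_powers_product_ge\<close>.\<close>

lemma Lambert_weight_decreasing:
  fixes t :: real
  assumes t: "0 < t" "t < 1" and n: "n > 0"
  shows "1 / (real (Suc n) * (1 - t)) - t ^ Suc n / (1 - t ^ Suc n)
       \<le> 1 / (real n * (1 - t)) - t ^ n / (1 - t ^ n)"
proof -
  define A where "A = (\<Sum>i<n. t ^ i)"
  define B where "B = (\<Sum>i<Suc n. t ^ i)"
  have eqA: "1 - t ^ n = (1 - t) * A" and eqB: "1 - t ^ Suc n = (1 - t) * B"
    using t by (auto simp: A_def B_def sum_gp_strict simp del: power_Suc sum.lessThan_Suc)
  have pos: "A > 0" "B > 0"
    unfolding A_def B_def using t n by (auto intro!: sum_pos simp del: sum.lessThan_Suc)
  have BA: "B = 1 + t * A"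
    unfolding A_def B_def sum.lessThan_Suc_shift by (simp add: sum_distrib_left)
  have key: "real n * real (Suc n) * t ^ n \<le> A * B"
    unfolding A_def B_def using t by (intro sum_powers_product_ge) auto
  have "t ^ n / A - t ^ Suc n / B = t ^ n / (A * B)"
    using pos BA by (simp add: field_simps)
  also have "\<dots> \<le> 1 / (real n * real (Suc n))"
    using key pos n by (simp add: pos_divide_le_eq pos_le_divide_eq mult_ac del: of_nat_Suc)
  also have "\<dots> = 1 / real n - 1 / real (Suc n)"
    using n by (simp add: field_simps)
  finally have "(t ^ n / A - t ^ Suc n / B) / (1 - t) \<le> (1 / real n - 1 / real (Suc n)) / (1 - t)"
    using t by (intro divide_right_mono) auto
  then show ?thesis
    unfolding eqA eqB by (simp add: diff_divide_distrib mult.commute del: power_Suc of_nat_Suc)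
qed

text \<open>Abel summation bounds the Lambert series by \<open>C\<close> uniformly in
  \<open>t\<close>. As a power series it has nonnegative coefficients, at least 1 at squares, so
  finitely many square terms exceed \<open>C\<close> as \<open>t\<close> tends to 1.\<close>

lemma real_character_L_one_nonzero:
  fixes h :: "nat \<Rightarrow> real"
  assumes mult: "\<And>m n. h (m * n) = h m * h n" and one: "h 1 = 1"
    and val: "\<And>n. h n \<in> {-1, 0, 1}" and bnd: "\<And>n. \<bar>\<Sum>k<n. h (Suc k)\<bar> \<le> C"
  shows "\<not> (\<lambda>n. h (Suc n) / real (Suc n)) sums 0"
proof
  assume zero: "(\<lambda>n. h (Suc n) / real (Suc n)) sums 0"
  have main: "(\<Sum>m=1..M. t ^ (m ^ 2)) \<le> C" if t: "0 < t" "t < 1" for t :: real and M :: nat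
  proof -
    \<comment> \<open>Since \<open>L(1, h) = 0\<close>, subtracting \<open>1 / (n (1 - t))\<close> does not change the Lambert series.\<close>
    define b where "b n = 1 / (real (Suc n) * (1 - t)) - t ^ Suc n / (1 - t ^ Suc n)" for n
    have dec: "b (Suc n) \<le> b n" for n
      unfolding b_def by (rule Lambert_weight_decreasing) (use t in auto)
    have lim: "b \<longlonglongrightarrow> 0"
    proof -
      have "(\<lambda>n. t ^ Suc n) \<longlonglongrightarrow> 0" using t by (intro LIMSEQ_Suc LIMSEQ_realpow_zero) auto
      then have "(\<lambda>n. 1 / real (Suc n) * (1 / (1 - t)) - t ^ Suc n / (1 - t ^ Suc n))
          \<longlonglongrightarrow> 0 * (1 / (1 - t)) - 0 / (1 - 0)"
        by (intro tendsto_intros inverse_Suc_tendsto_0) auto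
      then show ?thesis by (simp add: b_def[abs_def] del: power_Suc of_nat_Suc)
    qed
    \<comment> \<open>The first weight \<open>1/(1-t) - t/(1-t)\<close> does not depend on
      \<open>t\<close>; hence the uniform bound.\<close>
    have b0: "b 0 = 1" using t by (simp add: b_def field_simps)
    have "\<bar>h n\<bar> \<le> 1" for n using val[of n] by auto
    from Lambert_series_has_sum[OF this t] obtain S where
      S: "(\<lambda>n. h (Suc n) * (t ^ Suc n / (1 - t ^ Suc n))) sums S"
         "((\<lambda>m. (\<Sum>d | d dvd m. h d) * t ^ m) has_sum S) {1..}" .
    from sums_diff[OF sums_mult[OF zero, of "1 / (1 - t)"] S(1)]
    have "(\<lambda>n. h (Suc n) * of_real (b n)) sums (- S)"
      by (simp add: b_def algebra_simps del: power_Suc of_nat_Suc)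
    then have "S \<le> C"
      using Dirichlet_test(2)[of "\<lambda>k. h (Suc k)" C b, OF _ dec lim] bnd b0
      by (auto simp: sums_iff)
    have c: "0 \<le> (\<Sum>d | d dvd n. h d)" "is_square n \<Longrightarrow> 1 \<le> (\<Sum>d | d dvd n. h d)" if "n > 0" for n
      using divisor_sum_real_character[OF mult one val that] by auto
    have "(\<Sum>m=1..M. t ^ (m ^ 2)) = (\<Sum>m\<in>(\<lambda>m. m ^ 2) ` {1..M}. t ^ m)"
      by (subst sum.reindex) (auto intro!: inj_onI)
    also have "\<dots> \<le> (\<Sum>m\<in>(\<lambda>m. m ^ 2) ` {1..M}. (\<Sum>d | d dvd m. h d) * t ^ m)"
    proof (rule sum_mono)
      fix m assume "m \<in> (\<lambda>m. m ^ 2) ` {1..M}"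
      then have "m > 0" "is_square m" by auto
      then show "t ^ m \<le> (\<Sum>d | d dvd m. h d) * t ^ m"
        using mult_right_mono[OF c(2), of m "t ^ m"] t by simp
    qed
    also have "\<dots> \<le> S"
      by (rule finite_sum_le_has_sum[OF S(2)]) (use c t in auto)
    finally show ?thesis using \<open>S \<le> C\<close> by simp
  qed
  define M where "M = nat \<lceil>C\<rceil> + 1"
  have "((\<lambda>t. \<Sum>m=1..M. t ^ (m ^ 2)) \<longlongrightarrow> (\<Sum>m=1..M. 1 ^ (m ^ 2))) (at_left (1::real))"
    by (intro tendsto_intros)
  moreover have "\<forall>\<^sub>F t in at_left (1::real). (\<Sum>m=1..M. t ^ (m ^ 2)) \<le> C"
    using eventually_at_left_real[OF zero_less_one] by eventually_elim (rule main, auto)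
  ultimately have "(\<Sum>m=1..M. 1 ^ (m ^ 2)) \<le> C"
    by (rule tendsto_upperbound) simp
  then show False by (simp add: M_def) linarith
qed

section \<open>Nonvanishing for complex characters\<close>

text \<open>The map \<open>n \<mapsto> q n\<close> carries the surviving indices \<open>A\<close>
  onto those of them divisible by \<open>q\<close>, so deleting the latter multiplies the sum by
  \<open>1 - f q\<close>.\<close>

lemma Euler_product_finite:
  fixes f :: "nat \<Rightarrow> complex"
  assumes mult: "\<And>m n. f (m * n) = f m * f n" and sm: "f summable_on UNIV"
    and P: "finite P" "\<And>p. p \<in> P \<Longrightarrow> prime p"
  shows "(\<Prod>p\<in>P. 1 - f p) * infsum f UNIV = infsum f {n. \<forall>p\<in>P. \<not> p dvd n}"
  using P
proof (induction P rule: finite_induct)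
  case empty
  then show ?case by simp
next
  case (insert q P)
  define A where "A = {n. \<forall>p\<in>P. \<not> p dvd n}"
  have q: "prime q" using insert by simp
  have "\<not> p dvd q" if "p \<in> P" for p
    using that insert primes_dvd_imp_eq[of p q] by auto
  then have "q * n \<in> A \<longleftrightarrow> n \<in> A" for n
    using insert.prems by (auto simp: A_def prime_dvd_mult_iff)
  then have qA: "(\<lambda>n. q * n) ` A = {n \<in> A. q dvd n}"
    by (auto simp: dvd_def)
  have smA: "f summable_on B" for B by (rule summable_on_subset_banach[OF sm]) simp
  have "infsum f {n \<in> A. q dvd n} = infsum (f \<circ> (\<lambda>n. q * n)) A"
    unfolding qA[symmetric] using q by (intro infsum_reindex inj_onI) auto
  also have "\<dots> = f q * infsum f A"
    by (simp add: o_def mult infsum_cmult_right')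
  finally have 1: "infsum f {n \<in> A. q dvd n} = f q * infsum f A" .
  have "{n. \<forall>p\<in>insert q P. \<not> p dvd n} = A - {n \<in> A. q dvd n}" by (auto simp: A_def)
  then have "infsum f {n. \<forall>p\<in>insert q P. \<not> p dvd n} = infsum f A - infsum f {n \<in> A. q dvd n}"
    by (simp only:) (rule infsum_Diff[OF smA smA], auto)
  also have "\<dots> = (1 - f q) * infsum f A" by (simp add: 1 algebra_simps)
  also have "infsum f A = (\<Prod>p\<in>P. 1 - f p) * infsum f UNIV"
    using insert by (simp add: A_def)
  finally show ?case using insert by (simp add: mult_ac)
qed

text \<open>After sieving by the primes up to \<open>N\<close>, every surviving index apart from 0
  and 1 exceeds \<open>N\<close>, so the error is at most a tail of the absolutely convergent
  series.\<close>

lemma Euler_product_limit: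
  fixes f :: "nat \<Rightarrow> complex"
  assumes mult: "\<And>m n. f (m * n) = f m * f n" and zero: "f 0 = 0" and one: "f 1 = 1"
    and sm: "summable (\<lambda>n. norm (f n))"
  shows "(\<lambda>N. (\<Prod>p | prime p \<and> p \<le> N. 1 - f p) * suminf f) \<longlonglongrightarrow> 1"
proof -
  define g where "g n = norm (f n)" for n
  have smg: "g summable_on B" for B
    by (rule summable_on_subset_banach[of _ UNIV])
       (use norm_summable_imp_summable_on[of g] sm in \<open>auto simp: g_def[abs_def]\<close>)
  have smf: "f summable_on B" for B
    by (rule abs_summable_summable) (use smg[of B] in \<open>simp add: g_def[abs_def]\<close>)
  have inf: "infsum f UNIV = suminf f"
    by (rule infsumI[OF norm_summable_imp_has_sum[OF sm]]) (use sm in \<open>simp add: summable_norm_cancel summable_sums\<close>)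
  have infg: "infsum g UNIV = suminf g"
    by (rule infsumI[OF norm_summable_imp_has_sum]) (use sm in \<open>simp_all add: g_def[abs_def] summable_sums\<close>)
  have le: "norm ((\<Prod>p | prime p \<and> p \<le> N. 1 - f p) * suminf f - 1) \<le> suminf g - (\<Sum>n\<le>N. g n)"
    for N
  proof -
    define A where "A = {n. \<forall>p\<in>{p. prime p \<and> p \<le> N}. \<not> p dvd n}"
    have one_A: "1 \<in> A" by (auto simp: A_def)
    \<comment> \<open>0 survives only when no prime is at most \<open>N\<close>, and then
      contributes \<open>f 0 = 0\<close>.\<close>
    have sub: "A - {0, 1} \<subseteq> {Suc N..}"
    proof
      fix n assume n: "n \<in> A - {0, 1}"
      then obtain p where p: "prime p" "p dvd n" using prime_factor_nat by auto
      then have "p \<le> n" using n by (auto simp: dvd_imp_le)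
      moreover have "N < p" using n p by (force simp: A_def)
      ultimately show "n \<in> {Suc N..}" by simp
    qed
    have "(\<Prod>p | prime p \<and> p \<le> N. 1 - f p) * suminf f = infsum f A"
      unfolding A_def inf[symmetric] by (rule Euler_product_finite[OF mult smf]) auto
    also have "\<dots> = infsum f (insert 1 (A - {0, 1}))"
      by (rule infsum_cong_neutral) (use zero one_A in auto)
    also have "\<dots> = 1 + infsum f (A - {0, 1})"
      by (subst infsum_insert) (use smf one in auto)
    finally have "norm ((\<Prod>p | prime p \<and> p \<le> N. 1 - f p) * suminf f - 1) = norm (infsum f (A - {0, 1}))"
      by simp
    also have "\<dots> \<le> infsum g (A - {0, 1})"
      unfolding g_def using smg by (intro norm_infsum_bound) (simp add: g_def[abs_def])
    also have "\<dots> \<le> infsum g {Suc N..}"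
      by (rule infsum_mono2[OF smg smg sub]) (simp add: g_def)
    also have "{Suc N..} = UNIV - {..N}" by auto
    also have "infsum g (UNIV - {..N}) = suminf g - (\<Sum>n\<le>N. g n)"
      by (subst infsum_Diff) (use smg infg in auto)
    finally show ?thesis .
  qed
  have "(\<lambda>N. suminf g - (\<Sum>n\<le>N. g n)) \<longlonglongrightarrow> suminf g - suminf g"
    using sm by (intro tendsto_intros summable_LIMSEQ') (simp add: g_def[abs_def])
  then have "(\<lambda>N. (\<Prod>p | prime p \<and> p \<le> N. 1 - f p) * suminf f - 1) \<longlonglongrightarrow> 0"
    by (intro Lim_null_comparison[OF always_eventually[OF allI[OF le]]]) simp
  then show ?thesis by (simp add: LIM_zero_iff)
qed

section \<open>The 3-4-1 inequality for one Euler factor\<close>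

lemma ln_norm_one_minus_sums:
  fixes w :: complex
  assumes "norm w < 1"
  shows "(\<lambda>n. - Re (w ^ n) / real n) sums ln (norm (1 - w))"
proof -
  have "(\<lambda>n. - (w ^ n) / of_nat n) sums Ln (1 - w)"
    using Ln_series'[of "- w"] assms by simp
  from sums_Re[OF this] have "(\<lambda>n. Re (- (w ^ n) / of_nat n)) sums Re (Ln (1 - w))" .
  moreover have "Re (- (w ^ n) / of_nat n) = - Re (w ^ n) / real n" for n
    by (metis Re_divide_of_real of_real_of_nat_eq uminus_complex.simps(1))
  moreover have "1 - w \<noteq> 0" using assms by auto
  ultimately show ?thesis by (simp add: Re_Ln)
qed

text \<open>In the logarithm the \<open>n\<close>-th term is \<open>- r^n/n\<close> times
  \<open>3 + 4 cos x + cos 2x = 2 (1 + cos x)^2\<close>, where \<open>z^n = cis x\<close>.\<close>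

lemma three_four_one:
  fixes z :: complex and r :: real
  assumes r: "0 \<le> r" "r < 1" and z: "norm z = 1"
  shows "(1 - r) ^ 3 * norm (1 - of_real r * z) ^ 4 * norm (1 - of_real r * z\<^sup>2) \<le> 1"
proof -
  have "norm (of_real r :: complex) < 1" "norm (of_real r * z) < 1" "norm (of_real r * z\<^sup>2) < 1"
    using r z by (simp_all add: norm_mult norm_power)
  note s = this[THEN ln_norm_one_minus_sums]
  define g where "g n = 3 * (- Re (of_real r ^ n) / real n) + 4 * (- Re ((of_real r * z) ^ n) / real n)
      + (- Re ((of_real r * z\<^sup>2) ^ n) / real n)" for n
  have sums: "g sums (3 * ln (norm (1 - complex_of_real r)) + 4 * ln (norm (1 - of_real r * z))
      + ln (norm (1 - of_real r * z\<^sup>2)))"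
    unfolding g_def[abs_def] by (intro sums_add sums_mult s)
  have "g n \<le> 0" for n
  proof -
    define c d where "c = Re (z ^ n)" and "d = Im (z ^ n)"
    have cd: "c\<^sup>2 + d\<^sup>2 = 1"
      using z by (simp add: c_def d_def cmod_power2[symmetric] norm_power)
    have "(z\<^sup>2) ^ n = (z ^ n)\<^sup>2" by (simp add: power_mult[symmetric] mult.commute)
    then have "Re ((z\<^sup>2) ^ n) = c\<^sup>2 - d\<^sup>2"
      by (simp add: c_def d_def Re_power2)
    then have "g n = 3 * (- (r ^ n) / real n) + 4 * (- (r ^ n * c) / real n) + - (r ^ n * (c\<^sup>2 - d\<^sup>2)) / real n"
      unfolding g_def power_mult_distrib of_real_power[symmetric] Re_complex_of_real c_def[symmetric]
      by (simp add: c_def del: of_real_power)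
    also have "\<dots> = - (r ^ n / real n * (3 + 4 * c + (c\<^sup>2 - d\<^sup>2)))"
      by (cases "n = 0") (simp_all add: field_simps)
    also have "3 + 4 * c + (c\<^sup>2 - d\<^sup>2) = 2 * (1 + c)\<^sup>2"
      using cd by (simp add: power2_eq_square algebra_simps)
    finally show ?thesis using r by simp
  qed
  then have "3 * ln (norm (1 - complex_of_real r)) + 4 * ln (norm (1 - of_real r * z))
      + ln (norm (1 - of_real r * z\<^sup>2)) \<le> 0"
    by (rule sums_le[OF _ sums sums_zero])
  moreover have pos: "norm (1 - of_real r * z) > 0" "norm (1 - of_real r * z\<^sup>2) > 0"
    using r z norm_mult[of "of_real r" z] norm_mult[of "of_real r" "z\<^sup>2"]
    by (auto simp: norm_power)
  moreover have "norm (1 - complex_of_real r) = 1 - r"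
    using r by (metis abs_of_nonneg diff_ge_0_iff_ge less_imp_le norm_of_real of_real_1 of_real_diff)
  ultimately have "ln ((1 - r) ^ 3 * norm (1 - of_real r * z) ^ 4 * norm (1 - of_real r * z\<^sup>2)) \<le> 0"
    using r by (simp add: ln_mult ln_realpow)
  then show ?thesis
    using pos r by (subst (asm) ln_le_zero_iff) auto
qed

section \<open>Dirichlet series at real arguments near 1\<close>

lemma powr_tendsto_0_Suc:
  assumes "\<delta> > 0"
  shows "(\<lambda>n. real (Suc n) powr - \<delta>) \<longlonglongrightarrow> 0"
  using assms by (intro tendsto_neg_powr filterlim_compose[OF filterlim_real_sequentially] filterlim_Suc) auto

text \<open>An integral test through the mean value theorem: later terms are bounded by differences
  of \<open>x powr -\<delta>\<close> over \<open>\<delta>\<close>, which telescope to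
  \<open>1/\<delta>\<close>. The extra 1 is the first term.\<close>

lemma zeta_le:
  fixes \<delta> :: real
  assumes d: "\<delta> > 0"
  shows "summable (\<lambda>n. real (Suc n) powr - (1 + \<delta>))"
    and "(\<Sum>n. real (Suc n) powr - (1 + \<delta>)) \<le> 1 + 1 / \<delta>"
proof -
  define v where "v n = real (Suc n) powr - \<delta>" for n
  define u where "u n = real (Suc n) powr - (1 + \<delta>)" for n
  have le: "u (Suc n) \<le> (v n - v (Suc n)) / \<delta>" for n
  proof -
    have "\<exists>z. real (Suc n) < z \<and> z < real (Suc (Suc n)) \<and>
        real (Suc (Suc n)) powr - \<delta> - real (Suc n) powr - \<delta>
          = (real (Suc (Suc n)) - real (Suc n)) * (- \<delta> * z powr (- \<delta> - 1))"
      by (rule MVT2) (auto intro!: derivative_eq_intros simp: powr_diff)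
    then obtain z where z: "real (Suc n) < z" "z < real (Suc (Suc n))"
        "v n - v (Suc n) = \<delta> * z powr (- \<delta> - 1)" by (auto simp: v_def)
    have "- (1 + \<delta>) = - \<delta> - 1" by simp
    then have "u (Suc n) \<le> z powr (- \<delta> - 1)"
      unfolding u_def using z d by (simp only:) (intro powr_mono2', auto)
    then show ?thesis using z d by simp
  qed
  have "v \<longlonglongrightarrow> 0" unfolding v_def by (rule powr_tendsto_0_Suc[OF d])
  from sums_divide[OF telescope_sums'[OF this], of \<delta>]
  have sums: "(\<lambda>n. (v n - v (Suc n)) / \<delta>) sums (1 / \<delta>)" by (simp add: v_def)
  then have sm: "summable (\<lambda>n. u (Suc n))"
    using le by (intro summable_comparison_test'[OF sums_summable[OF sums]]) (auto simp: u_def)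
  then have smu: "summable u" by (simp only: summable_Suc_iff)
  then show "summable (\<lambda>n. real (Suc n) powr - (1 + \<delta>))"
    unfolding u_def .
  have "(\<Sum>n. u n) = (\<Sum>n. u (Suc n)) + u 0"
    using suminf_split_head[OF smu] by simp
  also have "(\<Sum>n. u (Suc n)) \<le> 1 / \<delta>"
    using suminf_le[OF le sm sums_summable[OF sums]] sums by (simp add: sums_iff)
  finally show "(\<Sum>n. real (Suc n) powr - (1 + \<delta>)) \<le> 1 + 1 / \<delta>"
    by (simp add: u_def)
qed

text \<open>The derivative of \<open>1/y - y powr -(1 + \<delta>)\<close> is
  \<open>((1 + \<delta>) y powr -\<delta> - 1) / y^2\<close>, and
  \<open>1 - y powr -\<delta> \<le> \<delta> ln y\<close> produces the decisive factor
  \<open>\<delta>\<close>. The logarithm is absorbed in a square root, which leaves the summable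
  exponent \<open>-3/2\<close>.\<close>

lemma powr_difference_variation:
  fixes \<delta> x :: real
  assumes d: "\<delta> > 0" and x: "x \<ge> 1"
  shows "\<bar>(1 / x - x powr - (1 + \<delta>)) - (1 / (x + 1) - (x + 1) powr - (1 + \<delta>))\<bar>
      \<le> 2 * \<delta> * x powr - (3 / 2)"
proof -
  define g where "g y = 1 / y - y powr - (1 + \<delta>)" for y :: real
  define g' where "g' y = - (1 / y\<^sup>2) + (1 + \<delta>) * y powr (- (1 + \<delta>) - 1)" for y :: real
  have "\<exists>z. x < z \<and> z < x + 1 \<and> g (x + 1) - g x = (x + 1 - x) * g' z"
  proof (rule MVT2)
    show "(g has_real_derivative g' y) (at y)" if "x \<le> y" "y \<le> x + 1" for y
      unfolding g_def[abs_def] g'_def using that x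
      by (auto intro!: derivative_eq_intros simp: power2_eq_square field_simps)
  qed simp
  then obtain z where z: "x < z" "z < x + 1" "g (x + 1) - g x = g' z" by auto
  have z0: "z > 1" using x z by simp
  define e where "e = z powr - \<delta>"
  have e: "0 < e" "e \<le> 1" "1 - e \<le> \<delta> * ln z"
  proof -
    show "0 < e" "e \<le> 1" using z0 d by (auto simp: e_def powr_minus intro!: inverse_le_1_iff[THEN iffD2] ge_one_powr_ge_zero)
    have "1 + - \<delta> * ln z \<le> exp (- \<delta> * ln z)" by (rule exp_ge_add_one_self)
    then show "1 - e \<le> \<delta> * ln z" using z0 by (simp add: e_def powr_def)
  qed
  have lnz: "ln z + 1 \<le> 2 * sqrt z"
    using ln_le_minus_one[of "sqrt z"] z0 by (simp add: ln_sqrt)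
  have "g' z = (1 / z\<^sup>2) * ((1 + \<delta>) * e - 1)"
    using z0 by (simp add: g'_def e_def powr_diff powr_minus powr_add power2_eq_square field_simps)
  moreover have "\<bar>(1 + \<delta>) * e - 1\<bar> \<le> 2 * \<delta> * sqrt z"
  proof -
    have "\<delta> * e \<le> \<delta> * 1" "0 \<le> \<delta> * e" "0 \<le> \<delta> * ln z"
      using d e z0 by (auto intro: mult_left_mono)
    then have "\<bar>(1 + \<delta>) * e - 1\<bar> \<le> \<delta> * (ln z + 1)"
      using e d unfolding distrib_left distrib_right by linarith
    also have "\<dots> \<le> \<delta> * (2 * sqrt z)" using d lnz by (intro mult_left_mono) auto
    finally show ?thesis by (simp add: mult_ac)
  qed
  ultimately have "\<bar>g' z\<bar> \<le> (1 / z\<^sup>2) * (2 * \<delta> * sqrt z)"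
    by (simp only: abs_mult) (rule mult_mono, auto)
  also have "\<dots> = 2 * \<delta> * z powr - (3 / 2)"
  proof -
    have "z powr - (3 / 2) = z powr (1 / 2 - 2)" by simp
    also have "\<dots> = sqrt z / z\<^sup>2" unfolding powr_diff using z0 by (simp add: powr_half_sqrt)
    finally show ?thesis by simp
  qed
  also have "\<dots> \<le> 2 * \<delta> * x powr - (3 / 2)"
    using d x z by (intro mult_left_mono powr_mono2') auto
  finally have "\<bar>g' z\<bar> \<le> 2 * \<delta> * x powr - (3 / 2)" .
  moreover have "\<bar>g x - g (x + 1)\<bar> = \<bar>g' z\<bar>" using z(3) by linarith
  ultimately show ?thesis by (simp add: g_def)
qed

text \<open>First-order vanishing of \<open>L(s, h)\<close> at \<open>s = 1\<close>: subtract the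
  series at 1, whose value is 0, and estimate the variation of the remaining weights.\<close>

lemma L_near_one:
  fixes h :: "nat \<Rightarrow> complex"
  assumes bnd: "\<And>n. norm (\<Sum>k<n. h (Suc k)) \<le> C"
    and zero: "(\<lambda>n. h (Suc n) / of_nat (Suc n)) sums 0" and d: "\<delta> > 0"
  shows "norm (\<Sum>n. h (Suc n) * of_real (real (Suc n) powr - (1 + \<delta>)))
      \<le> C * (2 * \<delta> * (\<Sum>n. real (Suc n) powr - (3 / 2)))"
proof -
  define b where "b n = 1 / real (Suc n) - real (Suc n) powr - (1 + \<delta>)" for n
  have C: "C \<ge> 0" using bnd[of 0] by simp
  have sm: "summable (\<lambda>n. real (Suc n) powr - (3 / 2))"
    using zeta_le(1)[of "1 / 2"] by simp
  have le: "\<bar>b n - b (Suc n)\<bar> \<le> 2 * \<delta> * real (Suc n) powr - (3 / 2)" for n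
    using powr_difference_variation[OF d, of "real (Suc n)"] by (simp add: b_def add.commute)
  have smb: "summable (\<lambda>n. \<bar>b n - b (Suc n)\<bar>)"
    using le by (intro summable_comparison_test'[OF summable_mult[OF sm, of "2 * \<delta>"]]) auto
  have lim: "b \<longlonglongrightarrow> 0"
    unfolding b_def using tendsto_diff[OF inverse_Suc_tendsto_0 powr_tendsto_0_Suc[of "1 + \<delta>"]] d by simp
  note test = bounded_variation_test[of "\<lambda>k. h (Suc k)", OF bnd smb lim]
  from sums_diff[OF zero summable_sums[OF test(1)]]
  have "(\<lambda>n. h (Suc n) * of_real (real (Suc n) powr - (1 + \<delta>))) sums
      (0 - (\<Sum>n. h (Suc n) * of_real (b n)))"
    by (simp add: b_def algebra_simps del: of_nat_Suc)
  then have "norm (\<Sum>n. h (Suc n) * of_real (real (Suc n) powr - (1 + \<delta>)))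
      = norm (\<Sum>n. h (Suc n) * of_real (b n))"
    by (simp add: sums_iff)
  also have "\<dots> \<le> C * (\<Sum>n. \<bar>b n - b (Suc n)\<bar>)" by (rule test(2))
  also have "(\<Sum>n. \<bar>b n - b (Suc n)\<bar>) \<le> (\<Sum>n. 2 * \<delta> * real (Suc n) powr - (3 / 2))"
    by (rule suminf_le[OF le smb summable_mult[OF sm]])
  also have "\<dots> = 2 * \<delta> * (\<Sum>n. real (Suc n) powr - (3 / 2))"
    by (rule suminf_mult[OF sm])
  finally show ?thesis using C by (simp add: mult_left_mono)
qed

text \<open>Truncated Euler products times their series tend to 1, while the local factors taken to
  the powers 3, 4, 1 multiply to at most 1, by \<open>three_four_one\<close> or trivially where
  \<open>h p = 0\<close>.\<close>

lemma three_four_one_L: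
  fixes h :: "nat \<Rightarrow> complex" and \<delta> :: real
  assumes mult: "\<And>m n. h (m * n) = h m * h n" and one: "h 1 = 1"
    and val: "\<And>n. h n = 0 \<or> norm (h n) = 1" and d: "\<delta> > 0"
  defines "w \<equiv> \<lambda>n. real (Suc n) powr - (1 + \<delta>)"
  shows "1 \<le> (\<Sum>n. w n) ^ 3 * norm (\<Sum>n. h (Suc n) * of_real (w n)) ^ 4 *
    norm (\<Sum>n. (h (Suc n))\<^sup>2 * of_real (w n))"
proof -
  define r where "r n = real n powr - (1 + \<delta>)" for n
  \<comment> \<open>\<open>r 0 = 0\<close> because \<open>0 powr a = 0\<close>; so index 0
    contributes nothing, even for the constant coefficient 1.\<close>
  have r: "r (Suc n) = w n" "r 0 = 0" "r 1 = 1" "r (m * n) = r m * r n" "0 \<le> r n" for m n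
    by (simp_all add: r_def w_def powr_mult)
  have rp: "r p < 1" if "prime p" for p
    using powr_less_mono2_neg[of "- (1 + \<delta>)" 1 "real p"] prime_gt_1_nat[OF that] d by (simp add: r_def)
  have smw: "summable w" unfolding w_def by (rule zeta_le(1)[OF d])
  have euler: "(\<lambda>N. (\<Prod>p | prime p \<and> p \<le> N. 1 - g p * of_real (r p)) *
      (\<Sum>n. g (Suc n) * of_real (w n))) \<longlonglongrightarrow> 1"
    if g: "\<And>m n. g (m * n) = g m * g n" "g 1 = 1" "\<And>n. norm (g n) \<le> 1" for g :: "nat \<Rightarrow> complex"
  proof -
    define f where "f n = g n * of_real (r n)" for n
    have "summable (\<lambda>n. norm (f (Suc n)))"
    proof (rule summable_comparison_test'[OF smw, of 0])
      show "norm (norm (f (Suc n))) \<le> w n" for n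
        using mult_right_mono[OF g(3), of "r (Suc n)" "Suc n"] r(5)[of "Suc n"] 
        by (simp add: f_def norm_mult r(1))
    qed
    then have sm: "summable (\<lambda>n. norm (f n))" by (subst (asm) summable_Suc_iff)
    have "suminf f = (\<Sum>n. g (Suc n) * of_real (w n))"
      using suminf_split_head[OF summable_norm_cancel[OF sm]] by (simp add: f_def[abs_def] r)
    moreover have "(\<lambda>N. (\<Prod>p | prime p \<and> p \<le> N. 1 - f p) * suminf f) \<longlonglongrightarrow> 1"
      by (rule Euler_product_limit[OF _ _ _ sm]) (use g r in \<open>simp_all add: f_def\<close>)
    ultimately show ?thesis by (simp add: f_def)
  qed
  define L0 L1 L2 where "L0 = (\<Sum>n. 1 * complex_of_real (w n))"
    and "L1 = (\<Sum>n. h (Suc n) * of_real (w n))" and "L2 = (\<Sum>n. (h (Suc n))\<^sup>2 * of_real (w n))"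
  define Q0 Q1 Q2 where "Q0 N = (\<Prod>p | prime p \<and> p \<le> N. 1 - 1 * complex_of_real (r p))"
    and "Q1 N = (\<Prod>p | prime p \<and> p \<le> N. 1 - h p * of_real (r p))"
    and "Q2 N = (\<Prod>p | prime p \<and> p \<le> N. 1 - (h p)\<^sup>2 * of_real (r p))" for N
  have hle: "norm (h n) \<le> 1" for n using val[of n] by auto
  have "(\<lambda>N. norm ((Q0 N * L0) ^ 3 * (Q1 N * L1) ^ 4 * (Q2 N * L2))) \<longlonglongrightarrow> norm (1 ^ 3 * 1 ^ 4 * 1 :: complex)"
    unfolding Q0_def Q1_def Q2_def L0_def L1_def L2_def
    by (intro tendsto_norm tendsto_mult tendsto_power euler[of "\<lambda>_. 1"] euler[of h] euler[of "\<lambda>n. (h n)\<^sup>2"])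
       (use one hle in \<open>auto simp: mult power_mult_distrib norm_power power_le_one\<close>)
  moreover have "norm ((Q0 N * L0) ^ 3 * (Q1 N * L1) ^ 4 * (Q2 N * L2)) \<le> norm L0 ^ 3 * norm L1 ^ 4 * norm L2" for N
  proof -
    have "norm (Q0 N) ^ 3 * norm (Q1 N) ^ 4 * norm (Q2 N) = (\<Prod>p | prime p \<and> p \<le> N.
        norm (1 - complex_of_real (r p)) ^ 3 * norm (1 - h p * of_real (r p)) ^ 4 * norm (1 - (h p)\<^sup>2 * of_real (r p)))"
      by (simp add: Q0_def Q1_def Q2_def prod_norm[symmetric] prod_power_distrib prod.distrib)
    also have "\<dots> \<le> 1"
    proof (rule prod_le_1, safe)
      fix p assume p: "prime p" "p \<le> N"
      have n: "norm (1 - complex_of_real (r p)) = 1 - r p"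
        using rp[OF p(1)] by (metis abs_of_nonneg diff_ge_0_iff_ge less_imp_le norm_of_real of_real_1 of_real_diff)
      show "norm (1 - complex_of_real (r p)) ^ 3 * norm (1 - h p * of_real (r p)) ^ 4 * norm (1 - (h p)\<^sup>2 * of_real (r p)) \<le> 1"
      proof (cases "h p = 0")
        case True
        then show ?thesis using rp[OF p(1)] r(5)[of p] by (simp add: n power_le_one)
      next
        case False
        then show ?thesis using three_four_one[of "r p" "h p"] val[of p] rp[OF p(1)] r(5)[of p]
          by (simp add: n mult.commute)
      qed
    qed simp
    finally have "norm (Q0 N) ^ 3 * norm (Q1 N) ^ 4 * norm (Q2 N) \<le> 1" .
    from mult_right_mono[OF this, of "norm L0 ^ 3 * norm L1 ^ 4 * norm L2"]
    show ?thesis by (simp add: norm_mult norm_power power_mult_distrib mult_ac)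
  qed
  ultimately have "norm (1 ^ 3 * 1 ^ 4 * 1 :: complex) \<le> norm L0 ^ 3 * norm L1 ^ 4 * norm L2"
    by (intro tendsto_upperbound[OF _ always_eventually]) auto
  moreover have "norm L0 = (\<Sum>n. w n)"
  proof -
    have "L0 = of_real (\<Sum>n. w n)" unfolding L0_def by (simp add: suminf_of_real[OF smw])
    moreover have "0 \<le> (\<Sum>n. w n)" by (rule suminf_nonneg[OF smw]) (simp add: w_def)
    ultimately show ?thesis by simp
  qed
  ultimately show ?thesis by (simp add: L1_def L2_def)
qed

text \<open>Up to a constant, 1 is bounded by \<open>(1/\<delta>)^3 \<delta>^4 = \<delta>\<close>.
  The bound \<open>D\<close> is what excludes real characters: for periodic \<open>h\<close> with
  values in \<open>{-1, 0, 1}\<close> the sums of \<open>h^2\<close> are unbounded.\<close>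

lemma complex_character_L_one_nonzero:
  fixes h :: "nat \<Rightarrow> complex"
  assumes mult: "\<And>m n. h (m * n) = h m * h n" and one: "h 1 = 1"
    and val: "\<And>n. h n = 0 \<or> norm (h n) = 1"
    and bnd: "\<And>n. norm (\<Sum>k<n. h (Suc k)) \<le> C"
    and bnd2: "\<And>n. norm (\<Sum>k<n. (h (Suc k))\<^sup>2) \<le> D"
  shows "\<not> (\<lambda>n. h (Suc n) / of_nat (Suc n)) sums 0"
proof
  assume zero: "(\<lambda>n. h (Suc n) / of_nat (Suc n)) sums 0"
  define K where "K = (\<Sum>n. real (Suc n) powr - (3 / 2))"
  define E where "E = 2 ^ 3 * (C * 2 * K) ^ 4 * D"
  have D: "D \<ge> 0" using bnd2[of 0] by simp
  have key: "1 \<le> E * \<delta>" if d: "0 < \<delta>" "\<delta> \<le> 1" for \<delta>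
  proof -
    define w where "w n = real (Suc n) powr - (1 + \<delta>)" for n
    have smw: "summable w" unfolding w_def by (rule zeta_le(1)[OF d(1)])
    have "(\<Sum>n. w n) \<le> 1 + 1 / \<delta>" unfolding w_def by (rule zeta_le(2)[OF d(1)])
    also have "\<dots> \<le> 2 / \<delta>" using d by (simp add: field_simps)
    finally have 0: "(\<Sum>n. w n) \<le> 2 / \<delta>" .
    have 1: "norm (\<Sum>n. h (Suc n) * of_real (w n)) \<le> C * (2 * \<delta> * K)"
      unfolding w_def K_def by (rule L_near_one[OF bnd zero d(1)])
    have 2: "norm (\<Sum>n. (h (Suc n))\<^sup>2 * of_real (w n)) \<le> D * w 0"
    proof (rule Dirichlet_test(2)[of "\<lambda>n. (h (Suc n))\<^sup>2", OF bnd2])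
      show "w (Suc n) \<le> w n" for n unfolding w_def using d by (intro powr_mono2') auto
      show "w \<longlonglongrightarrow> 0" unfolding w_def using d by (intro powr_tendsto_0_Suc) auto
    qed
    have "1 \<le> (\<Sum>n. w n) ^ 3 * norm (\<Sum>n. h (Suc n) * of_real (w n)) ^ 4 *
        norm (\<Sum>n. (h (Suc n))\<^sup>2 * of_real (w n))"
      unfolding w_def by (rule three_four_one_L[OF mult one val d(1)])
    also have "\<dots> \<le> (2 / \<delta>) ^ 3 * (C * (2 * \<delta> * K)) ^ 4 * D"
    proof (intro mult_mono power_mono)
      show "0 \<le> (\<Sum>n. w n)" by (rule suminf_nonneg[OF smw]) (simp add: w_def)
      show "norm (\<Sum>n. (h (Suc n))\<^sup>2 * of_real (w n)) \<le> D" using 2 by (simp add: w_def)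
    qed (use 0 1 d D in auto)
    also have "\<dots> = E * \<delta>"
      using d by (simp add: E_def field_simps power_mult_distrib) (simp add: power_numeral_reduce)
    finally show ?thesis .
  qed
  \<comment> \<open>\<open>E \<ge> 1\<close> makes \<open>1/(2 E)\<close> an admissible
    \<open>\<delta>\<close>; there the bound reads \<open>1 \<le> 1/2\<close>.\<close>
  have "E \<ge> 1" using key[of 1] by simp
  with key[of "1 / (2 * E)"] show False by simp
qed

section \<open>Periodic completely multiplicative functions\<close>

lemma periodic_mod:
  fixes a :: "nat \<Rightarrow> 'a"
  assumes per: "\<And>n. a (n + d) = a n"
  shows "a (n mod d) = a n"
proof -
  have "a (n + k * d) = a n" for n k
    by (induction k) (use per in \<open>simp_all add: add.assoc[symmetric] add.commute[of d]\<close>)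
  from this[of "n mod d" "n div d"] show ?thesis by simp
qed

text \<open>A full period contributes 0, so partial sums depend only on
  \<open>n mod d\<close>.\<close>

lemma periodic_partial_sums_bounded:
  fixes a :: "nat \<Rightarrow> complex"
  assumes per: "\<And>n. a (n + d) = a n" and d: "d > 0" and zero: "(\<Sum>n<d. a n) = 0"
  obtains C where "\<And>n. norm (\<Sum>k<n. a (Suc k)) \<le> C"
proof
  fix n
  have red: "(\<Sum>k<n. a k) = (\<Sum>k<n mod d. a k)" for n
  proof (induction n rule: less_induct)
    case (less n)
    show ?case
    proof (cases "n < d")
      case False
      have "(\<Sum>k<d + m. a k) = (\<Sum>k<d. a k) + (\<Sum>k<m. a (k + d))" for m
        by (induction m) (simp_all add: add_ac)
      from this[of "n - d"] have "(\<Sum>k<n. a k) = (\<Sum>k<d. a k) + (\<Sum>k<n - d. a (k + d))"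
        using False by simp
      then show ?thesis using less[of "n - d"] False d by (simp add: zero per le_mod_geq)
    qed simp
  qed
  have le: "norm (\<Sum>k<n. a k) \<le> (\<Sum>k<d. norm (a k))" for n
  proof -
    have "norm (\<Sum>k<n. a k) \<le> (\<Sum>k<n mod d. norm (a k))" unfolding red[of n] by (rule norm_sum)
    also have "\<dots> \<le> (\<Sum>k<d. norm (a k))"
      using mod_less_divisor[OF d, of n] by (intro sum_mono2) auto
    finally show ?thesis .
  qed
  have "(\<Sum>k<n. a (Suc k)) = (\<Sum>k<Suc n. a k) - a 0"
    unfolding sum.lessThan_Suc_shift by simp
  then show "norm (\<Sum>k<n. a (Suc k)) \<le> (\<Sum>k<d. norm (a k)) + norm (a 0)"
    using norm_triangle_ineq4[of "\<Sum>k<Suc n. a k" "a 0"] le[of "Suc n"] by simp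
qed

text \<open>A unit permutes the residues modulo \<open>d\<close>. This serves twice: as a reflection
  with \<open>c = d - 1\<close>, and to show that a sum is multiplied by a constant other than 1 and
  hence vanishes.\<close>

lemma sum_periodic_coprime_mult:
  fixes a :: "nat \<Rightarrow> complex"
  assumes per: "\<And>n. a (n + d) = a n" and d: "d > 0" and c: "coprime c d"
  shows "(\<Sum>r<d. a (c * r)) = (\<Sum>r<d. a r)"
proof -
  have inj: "inj_on (\<lambda>r. c * r mod d) {..<d}"
  proof (rule inj_onI)
    fix x y assume "x \<in> {..<d}" "y \<in> {..<d}" "c * x mod d = c * y mod d"
    then show "x = y"
      using cong_mult_lcancel_nat[OF c, of x y] by (simp add: cong_def)
  qed
  moreover have "(\<lambda>r. c * r mod d) ` {..<d} \<subseteq> {..<d}" using d by auto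
  ultimately have "bij_betw (\<lambda>r. c * r mod d) {..<d} {..<d}"
    using endo_inj_surj[of "{..<d}"] by (simp add: bij_betw_def)
  from sum.reindex_bij_betw[OF this, of a] show ?thesis
    by (simp add: periodic_mod[of a, OF per])
qed

text \<open>The nonzero values of \<open>h\<close> are roots of unity by Euler's theorem. If all
  squares are 0 or 1, then \<open>h\<close> is real; otherwise the squares sum to 0 over the least
  period, which supplies the second bound of the complex case.\<close>

lemma periodic_multiplicative_L_one_nonzero:
  fixes h :: "nat \<Rightarrow> complex"
  assumes mult: "\<And>m n. h (m * n) = h m * h n" and one: "h 1 = 1"
    and per: "\<And>n. h (n + N) = h n" and N: "N > 0" and zero: "(\<Sum>n<N. h n) = 0"
  shows "\<not> (\<lambda>n. h (Suc n) / of_nat (Suc n)) sums 0"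
proof -
  \<comment> \<open>\<open>h\<close> may be nonzero at some \<open>n\<close> not coprime to \<open>N\<close>; for the least period \<open>d\<close> this cannot happen.\<close>
  define d where "d = (LEAST d. d > 0 \<and> (\<forall>n. h (n + d) = h n))"
  have "d > 0 \<and> (\<forall>n. h (n + d) = h n)"
    unfolding d_def by (rule LeastI[of _ N]) (use N per in auto)
  then have d: "d > 0" "\<And>n. h (n + d) = h n" by auto
  have min: "d \<le> e" if "e > 0" "\<And>n. h (n + e) = h n" for e
    unfolding d_def by (rule Least_le) (use that in auto)
  have pow: "h (n ^ k) = h n ^ k" for n k
    by (induction k) (use one in \<open>simp_all add: mult\<close>)
  have cop: "coprime n d" if "h n \<noteq> 0" for n
  proof (rule ccontr)
    assume "\<not> coprime n d"
    then have "gcd n d \<noteq> 1" using coprime_iff_gcd_eq_1 by blast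
    then obtain p where p: "prime p" "p dvd n" "p dvd d"
      using prime_factor_nat[of "gcd n d"] by auto
    from p(2) have "h p \<noteq> 0" using that by (auto simp: mult elim!: dvdE)
    from p(3) obtain e where e: "d = p * e" by auto
    \<comment> \<open>Multiplicativity allows \<open>h p\<close> to be cancelled from
      \<open>h (p n + p e) = h (p n)\<close>, leaving the smaller period \<open>e\<close>.\<close>
    have "h p * h (n + e) = h p * h n" for n
    proof -
      have "h (p * n + d) = h (p * n)" by (rule d)
      then show ?thesis unfolding e mult[symmetric] by (simp add: distrib_left)
    qed
    then have "\<And>n. h (n + e) = h n" using \<open>h p \<noteq> 0\<close> by simp
    moreover have "e > 0" using e d by (cases e) auto
    ultimately have "d \<le> e" by (rule min[rotated])
    then show False using e prime_gt_1_nat[OF p(1)] \<open>e > 0\<close> by simp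
  qed
  have root: "h n ^ totient d = 1" if "h n \<noteq> 0" for n
  proof -
    have "n ^ totient d mod d = 1 mod d"
      using euler_theorem[OF cop[OF that]] by (simp add: cong_def)
    then show ?thesis
      using periodic_mod[of h d "n ^ totient d", OF d(2)] periodic_mod[of h d 1, OF d(2)] one by (simp add: pow)
  qed
  have "totient d > 0" using d by simp
  have val: "h n = 0 \<or> norm (h n) = 1" for n
  proof (cases "h n = 0")
    case False
    then have "norm (h n) ^ totient d = 1" using root by (metis norm_one norm_power)
    then show ?thesis using \<open>totient d > 0\<close> power_eq_imp_eq_base[of "norm (h n)" "totient d" 1] by simp
  qed simp
  obtain C where C: "\<And>n. norm (\<Sum>k<n. h (Suc k)) \<le> C"
    using periodic_partial_sums_bounded[of h, OF per N zero] by blast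
  show ?thesis
  proof (cases "\<forall>n. (h n)\<^sup>2 \<in> {0, 1}")
    case True
    have h: "h n \<in> {-1, 0, 1}" for n
      using True[rule_format, of n] by (auto simp: power2_eq_1_iff)
    define g where "g n = Re (h n)" for n
    have hg: "h n = of_real (g n)" for n using h[of n] by (auto simp: g_def)
    have "\<not> (\<lambda>n. g (Suc n) / real (Suc n)) sums 0"
    proof (rule real_character_L_one_nonzero)
      show "g (m * n) = g m * g n" for m n
        using mult[of m n] unfolding hg of_real_mult[symmetric] of_real_eq_iff .
      show "g 1 = 1" unfolding g_def one by simp
      show "g n \<in> {-1, 0, 1}" for n using h[of n] by (auto simp: g_def)
      show "\<bar>\<Sum>k<n. g (Suc k)\<bar> \<le> C" for n
        using C[of n] unfolding hg of_real_sum[symmetric] norm_of_real .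
    qed
    moreover have "h (Suc n) / of_nat (Suc n) = of_real (g (Suc n) / real (Suc n))" for n
      by (simp add: hg)
    ultimately show ?thesis
      by (simp only: sums_of_real_iff[where 'a = complex, of _ 0, unfolded of_real_0] not_False_eq_True)
  next
    case False
    then obtain c where c: "(h c)\<^sup>2 \<noteq> 0" "(h c)\<^sup>2 \<noteq> 1" by auto
    \<comment> \<open>\<open>h c \<noteq> 0\<close> makes \<open>c\<close> coprime to the least
      period \<open>d\<close>, so \<open>r \<mapsto> c r\<close> permutes the residues and
      multiplies the sum by \<open>(h c)^2 \<noteq> 1\<close>.\<close>
    have "(\<Sum>r<d. (h r)\<^sup>2) = (\<Sum>r<d. (h (c * r))\<^sup>2)"
      by (rule sum_periodic_coprime_mult[symmetric, of "\<lambda>n. (h n)\<^sup>2"]) (use d c cop in auto)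
    also have "\<dots> = (h c)\<^sup>2 * (\<Sum>r<d. (h r)\<^sup>2)"
      by (simp add: mult power_mult_distrib sum_distrib_left)
    finally have "(\<Sum>r<d. (h r)\<^sup>2) = 0" using c(2) by simp
    then obtain D where "\<And>n. norm (\<Sum>k<n. (h (Suc k))\<^sup>2) \<le> D"
      using periodic_partial_sums_bounded[of "\<lambda>n. (h n)\<^sup>2" d] d by auto
    from complex_character_L_one_nonzero[OF mult one val C this] show ?thesis .
  qed
qed

section \<open>Eigenvectors of dilations\<close>

text \<open>Write \<open>T\<close> for dilation by \<open>k\<close>, so that
  \<open>p(T) a = 0\<close>, and split \<open>p = (X - c) q\<close>. Either
  \<open>q(T) a = 0\<close> and the degree drops, or \<open>q(T) a\<close> is an eigenvector for
  \<open>c\<close>. The predicate \<open>Q\<close> encodes a \<open>T\<close>-stable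
  subspace.\<close>

lemma dilation_eigenvector:
  fixes Q :: "(nat \<Rightarrow> complex) \<Rightarrow> bool" and p :: "complex poly"
  assumes lin: "\<And>a b c. Q a \<Longrightarrow> Q b \<Longrightarrow> Q (\<lambda>n. a n + c * b n)" and zero: "Q (\<lambda>_. 0)"
    and dil: "\<And>a. Q a \<Longrightarrow> Q (\<lambda>n. a (k * n))"
    and a: "Q a" "a \<noteq> (\<lambda>_. 0)"
    and p: "p \<noteq> 0" "\<And>n. (\<Sum>i\<le>Polynomial.degree p. Polynomial.coeff p i * a (k ^ i * n)) = 0"
  shows "\<exists>b z. Q b \<and> b \<noteq> (\<lambda>_. 0) \<and> (\<forall>n. b (k * n) = z * b n)"
  using p
proof (induction "Polynomial.degree p" arbitrary: p)
  case 0
  have "Polynomial.coeff p 0 * a n = 0" for n using 0(1) 0(3)[of n] by simp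
  moreover have "Polynomial.coeff p 0 \<noteq> 0" using 0(1,2) by (metis leading_coeff_0_iff)
  ultimately show ?case using a by auto
next
  case (Suc m)
  have "\<not> constant (poly p)" using Suc(2) by (simp add: constant_degree)
  then obtain c where "poly p c = 0" using fundamental_theorem_of_algebra by blast
  then obtain q where q: "p = [:- c, 1:] * q" by (auto simp: poly_eq_0_iff_dvd)
  have "q \<noteq> 0" using q Suc(3) by auto
  then have deg: "Polynomial.degree p = Suc (Polynomial.degree q)" unfolding q by (subst degree_mult_eq) auto
  have dilp: "Q (\<lambda>n. a (k ^ i * n))" for i
  proof (induction i)
    case (Suc i)
    from dil[OF this] show ?case by (simp add: mult_ac)
  qed (use a in simp)
  define b where "b n = (\<Sum>i\<le>Polynomial.degree q. Polynomial.coeff q i * a (k ^ i * n))" for n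
  have "Q (\<lambda>n. \<Sum>i\<in>I. Polynomial.coeff q i * a (k ^ i * n))" if "finite I" for I
    using that
  proof (induction I rule: finite_induct)
    case (insert i I)
    from lin[OF insert.IH dilp, of "Polynomial.coeff q i" i] insert.hyps show ?case by (simp add: add.commute)
  qed (use zero in simp)
  then have "Q b" unfolding b_def by simp
  show ?case
  proof (cases "b = (\<lambda>_. 0)")
    case True
    then have "(\<Sum>i\<le>Polynomial.degree q. Polynomial.coeff q i * a (k ^ i * n)) = 0" for n
      unfolding b_def by (rule fun_cong)
    then show ?thesis using Suc(1)[of q] Suc(2) deg \<open>q \<noteq> 0\<close> by auto
  next
    case False
    have "b (k * n) = c * b n" for n
    proof -
      define A where "A i = a (k ^ i * n)" for i
      have coeff: "Polynomial.coeff p i = Polynomial.coeff (pCons 0 q) i - c * Polynomial.coeff q i" for i by (simp add: q)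
      have "0 = (\<Sum>i\<le>Suc (Polynomial.degree q). Polynomial.coeff p i * A i)" using Suc(4)[of n] deg by (simp add: A_def)
      also have "\<dots> = (\<Sum>i\<le>Suc (Polynomial.degree q). Polynomial.coeff (pCons 0 q) i * A i) - c * (\<Sum>i\<le>Suc (Polynomial.degree q). Polynomial.coeff q i * A i)"
        unfolding coeff by (simp only: left_diff_distrib sum_subtractf sum_distrib_left mult.assoc)
      also have "(\<Sum>i\<le>Suc (Polynomial.degree q). Polynomial.coeff (pCons 0 q) i * A i) = b (k * n)"
        unfolding sum.atMost_Suc_shift b_def A_def by (simp add: mult_ac)
      also have "(\<Sum>i\<le>Suc (Polynomial.degree q). Polynomial.coeff q i * A i) = b n"
        by (simp add: b_def A_def coeff_eq_0)
      finally show ?thesis by simp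
    qed
    with \<open>Q b\<close> False show ?thesis by blast
  qed
qed

text \<open>The first conjunct says that \<open>a\<close> is odd modulo \<open>N\<close>, and implies periodicity.\<close>

definition L_null :: "nat \<Rightarrow> (nat \<Rightarrow> complex) \<Rightarrow> bool" where
  "L_null N a \<longleftrightarrow> (\<forall>m n. N dvd m + n \<longrightarrow> a m + a n = 0) \<and>
     (\<forall>m. (\<lambda>n. a (m * Suc n) / of_nat (Suc n)) sums 0)"

lemma L_null_zero: "L_null N (\<lambda>_. 0)"
  by (simp add: L_null_def)

lemma L_null_linear:
  assumes "L_null N a" "L_null N b"
  shows "L_null N (\<lambda>n. a n + c * b n)"
  unfolding L_null_def
proof (intro conjI allI impI)
  fix m n assume "N dvd m + n"
  then have "a m + a n = 0" "b m + b n = 0" using assms by (auto simp: L_null_def)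
  then have "a n = - a m" "b n = - b m" by (auto simp: add_eq_0_iff)
  then show "a m + c * b m + (a n + c * b n) = 0" by simp
next
  fix m
  have "(\<lambda>n. a (m * Suc n) / of_nat (Suc n)) sums 0" "(\<lambda>n. b (m * Suc n) / of_nat (Suc n)) sums 0"
    using assms by (auto simp: L_null_def)
  from sums_add[OF this(1) sums_mult[OF this(2), of c]]
  show "(\<lambda>n. (a (m * Suc n) + c * b (m * Suc n)) / of_nat (Suc n)) sums 0"
    by (simp add: add_divide_distrib)
qed

lemma L_null_dilate:
  assumes "L_null N a"
  shows "L_null N (\<lambda>n. a (k * n))"
  unfolding L_null_def
proof (intro conjI allI impI)
  fix m n assume "N dvd m + n"
  then have "N dvd k * m + k * n" by (simp flip: distrib_left)
  then show "a (k * m) + a (k * n) = 0" using assms by (auto simp: L_null_def)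
next
  fix m
  have "(\<lambda>n. a ((k * m) * Suc n) / of_nat (Suc n)) sums 0" using assms by (auto simp: L_null_def)
  then show "(\<lambda>n. a (k * (m * Suc n)) / of_nat (Suc n)) sums 0" by (simp only: mult.assoc)
qed

text \<open>On natural numbers \<open>(N - 1) * n\<close> plays the part of \<open>-n\<close>;
  modulo \<open>N\<close> it is opposite to both \<open>n\<close> and \<open>n + N\<close>.\<close>

lemma L_null_periodic:
  assumes "L_null N a" "N > 0"
  shows "a (n + N) = a n"
proof -
  define m where "m = (N - 1) * n"
  have "n + m = N * n" using \<open>N > 0\<close> by (cases N) (auto simp: m_def)
  then have "N dvd n + m" "N dvd (n + N) + m" by (auto simp: add.commute add.left_commute)
  then have "a n + a m = 0" "a (n + N) + a m = 0" using assms by (auto simp: L_null_def)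
  then show ?thesis by (metis add_right_cancel)
qed

text \<open>Dilations commute, so the sequences with eigenvalues \<open>z\<close> on
  \<open>F\<close> form a subspace stable under the next dilation, and
  \<open>dilation_eigenvector\<close> applies inside it.\<close>

lemma L_null_common_eigenvector:
  assumes N: "N > 0" and a: "L_null N a" "a \<noteq> (\<lambda>_. 0)" and "finite F"
  shows "\<exists>b z. L_null N b \<and> b \<noteq> (\<lambda>_. 0) \<and> (\<forall>k\<in>F. \<forall>n. b (k * n) = z k * b n)"
  using \<open>finite F\<close>
proof (induction F rule: finite_induct)
  case empty
  then show ?case using a by auto
next
  case (insert k F)
  then obtain b z where b: "L_null N b" "b \<noteq> (\<lambda>_. 0)" "\<And>k n. k \<in> F \<Longrightarrow> b (k * n) = z k * b n" by blast
  define Q where "Q c \<longleftrightarrow> L_null N c \<and> (\<forall>k\<in>F. \<forall>n. c (k * n) = z k * c n)" for c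
  \<comment> \<open>Two powers of \<open>k\<close> agree modulo \<open>N\<close>, so
    \<open>X^j - X^i\<close> annihilates the dilation. Since \<open>k\<close> may share factors with
    \<open>N\<close>, \<open>i\<close> cannot in general be 0.\<close>
  have "\<not> inj (\<lambda>i. k ^ i mod N)"
  proof
    assume "inj (\<lambda>i. k ^ i mod N)"
    moreover have "range (\<lambda>i. k ^ i mod N) \<subseteq> {..<N}" using N by auto
    ultimately show False using finite_imageD finite_subset infinite_UNIV_nat by blast
  qed
  then obtain i j where ij: "i < j" "k ^ i mod N = k ^ j mod N"
    unfolding inj_def by (metis nat_neq_iff)
  define p :: "complex poly" where "p = Polynomial.monom 1 j - Polynomial.monom 1 i"
  have "Polynomial.coeff p j = 1" using ij by (simp add: p_def)
  then have "p \<noteq> 0" by auto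
  have "Polynomial.degree p \<le> j" unfolding p_def
    using ij degree_monom_le[of "1::complex" i] degree_monom_le[of "1::complex" j] by (intro degree_diff_le) auto
  have "\<exists>c y. Q c \<and> c \<noteq> (\<lambda>_. 0) \<and> (\<forall>n. c (k * n) = y * c n)"
  proof (rule dilation_eigenvector[where Q = Q and k = k and p = p])
    show "Q (\<lambda>n. a n + c * b n)" if "Q a" "Q b" for a b c
      using that L_null_linear by (auto simp: Q_def algebra_simps)
    show "Q (\<lambda>_. 0)" by (simp add: Q_def L_null_zero)
    show "Q (\<lambda>n. a (k * n))" if "Q a" for a
      using that L_null_dilate by (auto simp: Q_def mult.left_commute)
    show "Q b" using b by (simp add: Q_def)
    fix n
    have "b (k ^ i * n) = b (k ^ j * n)"
      using periodic_mod[of b N, OF L_null_periodic[OF b(1) N]] ij(2) by (metis mod_mult_left_eq)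
    moreover have "(\<Sum>l\<le>Polynomial.degree p. Polynomial.coeff p l * b (k ^ l * n)) = (\<Sum>l\<le>j. Polynomial.coeff p l * b (k ^ l * n))"
      using \<open>Polynomial.degree p \<le> j\<close> by (intro sum.mono_neutral_left) (auto simp: coeff_eq_0)
    moreover have "(\<Sum>l\<le>j. Polynomial.coeff p l * b (k ^ l * n)) = b (k ^ j * n) - b (k ^ i * n)"
      using ij by (simp add: p_def left_diff_distrib sum_subtractf if_distrib[of "\<lambda>x. x * _"] cong: if_cong)
    ultimately show "(\<Sum>l\<le>Polynomial.degree p. Polynomial.coeff p l * b (k ^ l * n)) = 0" by simp
  qed (use b \<open>p \<noteq> 0\<close> in auto)
  then obtain c y where c: "Q c" "c \<noteq> (\<lambda>_. 0)" "\<And>n. c (k * n) = y * c n" by blast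
  show ?case
    by (rule exI[of _ c], rule exI[of _ "z(k := y)"]) (use c insert in \<open>auto simp: Q_def\<close>)
qed

text \<open>A common eigenvector satisfies \<open>b m = z (m mod N) * b 1\<close>, so
  \<open>b 1 \<noteq> 0\<close> and \<open>b / b 1\<close> is completely multiplicative. The
  reflection \<open>r \<mapsto> (N - 1) r\<close> shows that its sum over a period is its own
  negative.\<close>

lemma L_null_imp_zero:
  assumes N: "N > 0" and a: "L_null N a"
  shows "a n = 0"
proof (rule ccontr)
  assume "a n \<noteq> 0"
  then have "a \<noteq> (\<lambda>_. 0)" by auto
  from L_null_common_eigenvector[OF N a this, of "{..<N}"] obtain b z where
    b: "L_null N b" "b \<noteq> (\<lambda>_. 0)" and z: "\<And>k n. k < N \<Longrightarrow> b (k * n) = z k * b n" by auto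
  note per = L_null_periodic[OF b(1) N]
  have bz: "b (m * n) = z (m mod N) * b n" for m n
  proof -
    have "b (m * n) = b ((m mod N) * n)"
      using periodic_mod[of b N, OF per] by (metis mod_mult_left_eq)
    then show ?thesis using z[of "m mod N" n] N by simp
  qed
  have "b 1 \<noteq> 0"
  proof
    assume "b 1 = 0"
    then have "b m = 0" for m using bz[of m 1] by simp
    then show False using b by auto
  qed
  define h where "h n = b n / b 1" for n
  have "h (m * n) = h m * h n" for m n
    using bz[of m n] bz[of m 1] \<open>b 1 \<noteq> 0\<close> by (simp add: h_def)
  moreover have "h 1 = 1" using \<open>b 1 \<noteq> 0\<close> by (simp add: h_def)
  moreover have hper: "h (n + N) = h n" for n by (simp add: h_def per)
  moreover have "(\<Sum>n<N. h n) = 0"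
  proof -
    have neg: "h ((N - 1) * r) = - h r" for r
    proof -
      have "(N - 1) * r + r = N * r" using N by (cases N) auto
      then have "N dvd (N - 1) * r + r" by simp
      then have "b ((N - 1) * r) + b r = 0" using b by (simp only: L_null_def)
      then have "b ((N - 1) * r) = - b r" by (simp only: add_eq_0_iff2)
      then show ?thesis by (simp only: h_def minus_divide_left)
    qed
    have "(\<Sum>r<N. h ((N - 1) * r)) = (\<Sum>r<N. h r)"
      by (rule sum_periodic_coprime_mult) (use N hper coprime_diff_one_left_nat in auto)
    then show ?thesis unfolding neg by (simp add: sum_negf)
  qed
  moreover have "(\<lambda>n. h (Suc n) / of_nat (Suc n)) sums 0"
  proof -
    have "(\<lambda>n. b (1 * Suc n) / of_nat (Suc n)) sums 0" using b by (simp only: L_null_def)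
    from sums_divide[OF this, of "b 1"] show ?thesis by (simp add: h_def mult.commute)
  qed
  ultimately show False using periodic_multiplicative_L_one_nonzero[of h N] N by blast
qed

section \<open>The dual group\<close>

lemma real_mod_int_cases:
  assumes "c \<in> carrier real_mod_int"
  obtains x where "c = \<int> #>\<^bsub>real_add_group\<^esub> x"
  using assms by (auto simp: FactGroup_def RCOSETS_def)

lemma rcoset_real_mod_int: "\<int> #>\<^bsub>real_add_group\<^esub> x \<in> carrier real_mod_int"
  by (auto simp: FactGroup_def RCOSETS_def real_add_group_def)

lemma rcoset_mult_real_mod_int:
  "(\<int> #>\<^bsub>real_add_group\<^esub> x) \<otimes>\<^bsub>real_mod_int\<^esub> (\<int> #>\<^bsub>real_add_group\<^esub> y) = \<int> #>\<^bsub>real_add_group\<^esub> (x + y)"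
proof -
  interpret comm_group real_add_group by (rule comm_group_real_add_group)
  interpret normal \<int> real_add_group
    by (simp add: normal_iff_subgroup subgroup_Ints)
  show ?thesis using rcos_sum[of x y] by (simp add: FactGroup_def real_add_group_def)
qed

lemma inv_rcoset_real_mod_int:
  "inv\<^bsub>real_mod_int\<^esub> (\<int> #>\<^bsub>real_add_group\<^esub> x) = \<int> #>\<^bsub>real_add_group\<^esub> (- x)"
proof -
  interpret comm_group real_mod_int by (rule comm_group_real_mod_int)
  have "\<int> #>\<^bsub>real_add_group\<^esub> 0 = \<one>\<^bsub>real_mod_int\<^esub>"
    by (auto simp: r_coset_def real_add_group_def FactGroup_def)
  then show ?thesis
    by (intro inv_equality rcoset_real_mod_int) (simp only: rcoset_mult_real_mod_int add.left_inverse)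
qed

text \<open>The standard character of R/Z; the chosen representative is immaterial by
  \<open>exp_mod_rcoset\<close>.\<close>

definition exp_mod :: "real set \<Rightarrow> complex" where
  "exp_mod c = cis (2 * pi * (SOME x. x \<in> c))"

lemma exp_mod_rcoset: "exp_mod (\<int> #>\<^bsub>real_add_group\<^esub> x) = cis (2 * pi * x)"
proof -
  have coset: "\<int> #>\<^bsub>real_add_group\<^esub> x = {k + x |k. k \<in> \<int>}"
    by (auto simp: r_coset_def real_add_group_def)
  have "x \<in> \<int> #>\<^bsub>real_add_group\<^esub> x" unfolding coset by (auto intro!: exI[of _ 0])
  then have "(SOME y. y \<in> \<int> #>\<^bsub>real_add_group\<^esub> x) \<in> \<int> #>\<^bsub>real_add_group\<^esub> x" by (rule someI)
  then obtain k where "k \<in> \<int>" "(SOME y. y \<in> \<int> #>\<^bsub>real_add_group\<^esub> x) = k + x" unfolding coset by auto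
  then show ?thesis
    by (auto simp: exp_mod_def distrib_left cis_mult[symmetric] cis_multiple_2pi elim!: Ints_cases)
qed

lemma norm_exp_mod [simp]: "norm (exp_mod c) = 1"
  by (simp add: exp_mod_def)

lemma exp_mod_mult:
  assumes "c \<in> carrier real_mod_int" "d \<in> carrier real_mod_int"
  shows "exp_mod (c \<otimes>\<^bsub>real_mod_int\<^esub> d) = exp_mod c * exp_mod d"
proof -
  obtain x y where "c = \<int> #>\<^bsub>real_add_group\<^esub> x" "d = \<int> #>\<^bsub>real_add_group\<^esub> y"
    using assms real_mod_int_cases by metis
  then show ?thesis by (simp only: rcoset_mult_real_mod_int exp_mod_rcoset cis_mult distrib_left)
qed

lemma exp_mod_inv:
  assumes "c \<in> carrier real_mod_int"
  shows "exp_mod (inv\<^bsub>real_mod_int\<^esub> c) = cnj (exp_mod c)"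
  using assms by (auto elim!: real_mod_int_cases
      simp: inv_rcoset_real_mod_int exp_mod_rcoset cis_cnj)

lemma inj_on_exp_mod: "inj_on exp_mod (carrier real_mod_int)"
proof (rule inj_onI)
  fix c d assume cd: "c \<in> carrier real_mod_int" "d \<in> carrier real_mod_int" "exp_mod c = exp_mod d"
  obtain x y where xy: "c = \<int> #>\<^bsub>real_add_group\<^esub> x" "d = \<int> #>\<^bsub>real_add_group\<^esub> y"
    using cd real_mod_int_cases by metis
  have "cis (2 * pi * x - 2 * pi * y) = 1"
    using cd(3) by (simp add: xy exp_mod_rcoset cis_divide[symmetric])
  then obtain k :: int where "2 * pi * x - 2 * pi * y = 2 * pi * of_int k"
    by (auto simp: complex_eq_iff cos_one_2pi_int mult_ac)
  then have "2 * pi * (x - y) = 2 * pi * of_int k" by (simp add: algebra_simps)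
  then have k: "x = y + of_int k" by simp
  have mem: "v \<in> \<int> #>\<^bsub>real_add_group\<^esub> w \<longleftrightarrow> v - w \<in> \<int>" for v w
    by (auto simp: r_coset_def real_add_group_def intro!: bexI[of _ "v - w"])
  have "v - (y + of_int k) \<in> \<int> \<longleftrightarrow> v - y \<in> \<int>" for v
    using Ints_add[of "v - (y + of_int k)" "of_int k"] Ints_diff[of "v - y" "of_int k"]
    by (auto simp: algebra_simps)
  then show "c = d" unfolding xy k by (auto simp: mem)
qed

lemma B1_minus: "B1 (- x) = - B1 x"
  by (simp add: B1_def frac_neg)

lemma B1_mod_inv:
  assumes "c \<in> carrier real_mod_int"
  shows "B1_mod (inv\<^bsub>real_mod_int\<^esub> c) = - B1_mod c"
  using assms by (auto elim!: real_mod_int_cases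
      simp: inv_rcoset_real_mod_int B1_mod_rcoset B1_minus)

lemma B1_mod_Fourier_series:
  assumes "c \<in> carrier real_mod_int"
  shows "(\<lambda>n. Im (exp_mod c ^ Suc n) / real (Suc n)) sums (- pi * B1_mod c)"
  using assms B1_Fourier_series by (auto elim!: real_mod_int_cases simp only: exp_mod_rcoset B1_mod_rcoset)

section \<open>Complex characters of a finite abelian group\<close>

context
  fixes G :: "('a, 'm) monoid_scheme"
  assumes G: "comm_group G" and fin: "finite (carrier G)"
begin

interpretation G: comm_group G by (rule G)
interpretation H: comm_group "dual_group G"
  by (rule comm_group_hom_group[OF G.is_group comm_group_real_mod_int])

abbreviation (input) "\<Phi> \<equiv> carrier (dual_group G)"
abbreviation (input) "dinv \<equiv> m_inv (dual_group G)"

lemma dual_closed: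
  assumes "\<phi> \<in> \<Phi>" "g \<in> carrier G"
  shows "\<phi> g \<in> carrier real_mod_int"
  using assms by (auto simp: hom_group_def hom_def)

lemma exp_mod_dual_mult:
  assumes "\<phi> \<in> \<Phi>" "g \<in> carrier G" "g' \<in> carrier G"
  shows "exp_mod (\<phi> (g \<otimes>\<^bsub>G\<^esub> g')) = exp_mod (\<phi> g) * exp_mod (\<phi> g')"
proof -
  have "\<phi> (g \<otimes>\<^bsub>G\<^esub> g') = \<phi> g \<otimes>\<^bsub>real_mod_int\<^esub> \<phi> g'"
    using assms by (simp add: hom_group_def hom_def)
  then show ?thesis using assms by (simp only: exp_mod_mult dual_closed)
qed

lemma exp_mod_dual_one:
  assumes "\<phi> \<in> \<Phi>"
  shows "exp_mod (\<phi> \<one>\<^bsub>G\<^esub>) = 1"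
proof -
  have "exp_mod (\<phi> \<one>\<^bsub>G\<^esub>) * exp_mod (\<phi> \<one>\<^bsub>G\<^esub>) = exp_mod (\<phi> \<one>\<^bsub>G\<^esub>) * 1"
    using exp_mod_dual_mult[OF assms G.one_closed G.one_closed] by simp
  moreover have "exp_mod (\<phi> \<one>\<^bsub>G\<^esub>) \<noteq> 0" by (metis norm_exp_mod norm_zero zero_neq_one)
  ultimately show ?thesis by (metis mult_left_cancel)
qed

lemma exp_mod_dual_pow:
  assumes "\<phi> \<in> \<Phi>" "g \<in> carrier G"
  shows "exp_mod (\<phi> (g [^]\<^bsub>G\<^esub> (n::nat))) = exp_mod (\<phi> g) ^ n"
  using assms by (induction n) (simp_all add: exp_mod_dual_one exp_mod_dual_mult mult.commute)

lemma exp_mod_dual_order: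
  assumes "\<phi> \<in> \<Phi>" "g \<in> carrier G"
  shows "exp_mod (\<phi> g) ^ Coset.order G = 1"
  using exp_mod_dual_pow[OF assms, of "Coset.order G"] exp_mod_dual_one[OF assms(1)] G.pow_order_eq_1[OF assms(2)]
  by simp

lemma inv_dual_apply:
  assumes "\<phi> \<in> \<Phi>" "g \<in> carrier G"
  shows "(dinv \<phi>) g = inv\<^bsub>real_mod_int\<^esub> (\<phi> g)"
  using inv_hom_group[OF G.is_group comm_group_real_mod_int assms(1)] assms(2) by simp

lemma dual_eqI:
  assumes "\<phi> \<in> \<Phi>" "\<psi> \<in> \<Phi>"
    and "\<And>g. g \<in> carrier G \<Longrightarrow> exp_mod (\<phi> g) = exp_mod (\<psi> g)"
  shows "\<phi> = \<psi>"
proof (rule extensionalityI[where A = "carrier G"])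
  show "\<phi> \<in> extensional (carrier G)" "\<psi> \<in> extensional (carrier G)"
    using assms by (auto simp: hom_group_def)
  show "\<phi> g = \<psi> g" if "g \<in> carrier G" for g
    using inj_onD[OF inj_on_exp_mod] assms dual_closed that by blast
qed

lemma order_pos: "Coset.order G > 0"
  using fin by (simp add: Coset.order_def card_gt_0_iff G.carrier_not_empty)

text \<open>A homomorphism is determined by its complex character, whose values are roots of unity
  for the exponent \<open>Coset.order G\<close>.\<close>

lemma finite_dual: "finite (\<Phi>)"
proof (rule finite_imageD)
  let ?f = "\<lambda>\<phi>. \<lambda>g\<in>carrier G. exp_mod (\<phi> g)"
  have "?f ` \<Phi> \<subseteq> carrier G \<rightarrow>\<^sub>E {z. z ^ Coset.order G = 1}"
    using exp_mod_dual_order by auto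
  moreover have "finite (carrier G \<rightarrow>\<^sub>E {z :: complex. z ^ Coset.order G = 1})"
    using fin order_pos by (intro finite_PiE finite_roots_unity) auto
  ultimately show "finite (?f ` \<Phi>)" by (rule finite_subset)
  show "inj_on ?f (\<Phi>)"
  proof (rule inj_onI)
    fix \<phi> \<psi> assume *: "\<phi> \<in> \<Phi>" "\<psi> \<in> \<Phi>" "?f \<phi> = ?f \<psi>"
    have "exp_mod (\<phi> g) = exp_mod (\<psi> g)" if "g \<in> carrier G" for g
      using fun_cong[OF *(3), of g] that by simp
    with *(1,2) show "\<phi> = \<psi>" by (rule dual_eqI)
  qed
qed

text \<open>For \<open>\<phi> \<noteq> \<psi>\<close> some \<open>u\<close> has
  \<open>\<theta> u \<noteq> 1\<close>, and translating the sum by \<open>u\<close> multiplies it by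
  \<open>\<theta> u\<close>.\<close>

lemma dual_orthogonality:
  assumes "\<phi> \<in> \<Phi>" "\<psi> \<in> \<Phi>"
  shows "(\<Sum>g\<in>carrier G. exp_mod (\<phi> g) * cnj (exp_mod (\<psi> g))) = (if \<phi> = \<psi> then of_nat (Coset.order G) else 0)"
proof (cases "\<phi> = \<psi>")
  case True
  have "exp_mod (\<psi> g) * cnj (exp_mod (\<psi> g)) = 1" for g
    by (simp add: complex_norm_square[symmetric])
  with True show ?thesis by (simp add: Coset.order_def)
next
  case False
  define \<theta> where "\<theta> g = exp_mod (\<phi> g) * cnj (exp_mod (\<psi> g))" for g
  obtain u where u: "u \<in> carrier G" "exp_mod (\<phi> u) \<noteq> exp_mod (\<psi> u)"
    using dual_eqI[OF assms] False by blast
  have "\<theta> u \<noteq> 1"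
  proof
    assume "\<theta> u = 1"
    then have "\<theta> u * exp_mod (\<psi> u) = exp_mod (\<psi> u)" by simp
    moreover have "\<theta> u * exp_mod (\<psi> u) = exp_mod (\<phi> u)"
      using complex_norm_square[of "exp_mod (\<psi> u)"] by (simp add: \<theta>_def mult.assoc mult.commute[of "cnj _"])
    ultimately show False using u by simp
  qed
  have mult: "\<theta> (u \<otimes>\<^bsub>G\<^esub> g) = \<theta> u * \<theta> g" if "g \<in> carrier G" for g
    using that u assms by (simp add: \<theta>_def exp_mod_dual_mult)
  have "bij_betw (\<lambda>g. u \<otimes>\<^bsub>G\<^esub> g) (carrier G) (carrier G)"
    using u by (intro bij_betwI[where g = "\<lambda>g. inv\<^bsub>G\<^esub> u \<otimes>\<^bsub>G\<^esub> g"]) (auto simp: G.m_assoc[symmetric])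
  from sum.reindex_bij_betw[OF this, of \<theta>] have "(\<Sum>g\<in>carrier G. \<theta> g) = \<theta> u * (\<Sum>g\<in>carrier G. \<theta> g)"
    by (simp add: mult sum_distrib_left)
  then show ?thesis using \<open>\<theta> u \<noteq> 1\<close> False by (simp add: \<theta>_def)
qed

lemma dual_Fourier_injective:
  assumes zero: "\<And>g. g \<in> carrier G \<Longrightarrow> (\<Sum>\<phi>\<in>\<Phi>. l \<phi> * exp_mod (\<phi> g)) = 0"
    and \<psi>: "\<psi> \<in> \<Phi>"
  shows "l \<psi> = 0"
proof -
  have "0 = (\<Sum>g\<in>carrier G. (\<Sum>\<phi>\<in>\<Phi>. l \<phi> * exp_mod (\<phi> g)) * cnj (exp_mod (\<psi> g)))"
    by (simp add: zero)
  also have "\<dots> = (\<Sum>\<phi>\<in>\<Phi>. l \<phi> * (\<Sum>g\<in>carrier G. exp_mod (\<phi> g) * cnj (exp_mod (\<psi> g))))"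
    unfolding sum_distrib_right sum_distrib_left by (subst sum.swap) (simp add: mult.assoc)
  also have "\<dots> = (\<Sum>\<phi>\<in>\<Phi>. if \<phi> = \<psi> then l \<psi> * of_nat (Coset.order G) else 0)"
    by (intro sum.cong refl) (simp add: dual_orthogonality \<psi>)
  also have "\<dots> = l \<psi> * of_nat (Coset.order G)" using finite_dual \<psi> by simp
  finally show ?thesis using order_pos by simp
qed

lemma sum_dual_inv:
  "(\<Sum>\<phi>\<in>\<Phi>. f (dinv \<phi>)) = (\<Sum>\<phi>\<in>\<Phi>. f \<phi>)"
  by (rule sum.reindex_bij_betw[OF bij_betwI[where g = "\<lambda>\<phi>. dinv \<phi>"]]) auto

section \<open>Odd functions annihilating every \<open>S_fun G g\<close>\<close>

text \<open>\<open>a n\<close> is the transform of \<open>l\<close> at the \<open>n\<close>-th power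
  of \<open>g\<close>. The series condition of \<open>L_null\<close> at \<open>m\<close> expresses
  annihilation of \<open>S_fun G u\<close> for \<open>u\<close> the \<open>m\<close>-th power of
  \<open>g\<close>.\<close>

lemma odd_annihilator_zero:
  assumes odd: "\<And>\<phi>. \<phi> \<in> \<Phi> \<Longrightarrow> l (dinv \<phi>) = - l \<phi>"
    and ann: "\<And>g. g \<in> carrier G \<Longrightarrow> (\<Sum>\<phi>\<in>\<Phi>. l \<phi> * S_fun G g \<phi>) = 0"
    and \<psi>: "\<psi> \<in> \<Phi>"
  shows "l \<psi> = 0"
proof (rule dual_Fourier_injective[OF _ \<psi>])
  fix g assume g: "g \<in> carrier G"
  define a where "a n = (\<Sum>\<phi>\<in>\<Phi>. l \<phi> * exp_mod (\<phi> g) ^ n)" for n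
  have cnj: "(\<Sum>\<phi>\<in>\<Phi>. l \<phi> * cnj (exp_mod (\<phi> u)) ^ n)
      = - (\<Sum>\<phi>\<in>\<Phi>. l \<phi> * exp_mod (\<phi> u) ^ n)" if u: "u \<in> carrier G" for u n
  proof -
    have "(\<Sum>\<phi>\<in>\<Phi>. l \<phi> * exp_mod (\<phi> u) ^ n)
        = (\<Sum>\<phi>\<in>\<Phi>. l (dinv \<phi>) * exp_mod ((dinv \<phi>) u) ^ n)"
      by (rule sum_dual_inv[symmetric])
    also have "\<dots> = (\<Sum>\<phi>\<in>\<Phi>. - (l \<phi> * cnj (exp_mod (\<phi> u)) ^ n))"
      by (intro sum.cong refl) (simp add: odd inv_dual_apply exp_mod_inv dual_closed u)
    finally show ?thesis by (simp add: sum_negf)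
  qed
  have "L_null (Coset.order G) a"
    unfolding L_null_def
  proof (intro conjI allI impI)
    fix m n assume "Coset.order G dvd m + n"
    then obtain k where k: "m + n = Coset.order G * k" by auto
    have "exp_mod (\<phi> g) ^ m = cnj (exp_mod (\<phi> g)) ^ n" if "\<phi> \<in> \<Phi>" for \<phi>
    proof -
      define z where "z = exp_mod (\<phi> g)"
      have "z * cnj z = 1" by (simp add: z_def complex_norm_square[symmetric])
      then have "z ^ m = z ^ (m + n) * cnj z ^ n"
        by (simp add: power_add mult.assoc flip: power_mult_distrib)
      also have "z ^ (m + n) = 1"
        unfolding k power_mult using exp_mod_dual_order[OF that g] by (simp add: z_def)
      finally show ?thesis by (simp add: z_def)
    qed
    then have "a m = - a n" unfolding a_def cnj[OF g, symmetric] by (intro sum.cong) auto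
    then show "a m + a n = 0" by simp
  next
    fix m :: nat
    define u where "u = g [^]\<^bsub>G\<^esub> m"
    have u: "u \<in> carrier G" using g by (simp add: u_def)
    \<comment> \<open>The Fourier series of \<open>B1\<close> sees only imaginary parts. As
      \<open>\<i> * Im w = (w - cnj w) / 2\<close> and \<open>l\<close> is odd, the conjugate half
      contributes as much as the other, so the factor \<open>\<i>\<close> recovers the full sum
      \<open>a\<close>.\<close>
    have "(\<lambda>n. \<Sum>\<phi>\<in>\<Phi>. l \<phi> * \<i> * of_real (Im (exp_mod (\<phi> u) ^ Suc n) / real (Suc n))) sums
        (\<Sum>\<phi>\<in>\<Phi>. l \<phi> * \<i> * of_real (- pi * B1_mod (\<phi> u)))"
      by (intro sums_sum sums_mult sums_of_real B1_mod_Fourier_series dual_closed u)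
    also have "(\<Sum>\<phi>\<in>\<Phi>. l \<phi> * \<i> * of_real (- pi * B1_mod (\<phi> u)))
        = - \<i> * of_real pi * (\<Sum>\<phi>\<in>\<Phi>. l \<phi> * S_fun G u \<phi>)"
      by (simp add: sum_distrib_left S_fun_def mult_ac)
    also have "\<dots> = 0" by (simp add: ann u)
    also have "(\<lambda>n. \<Sum>\<phi>\<in>\<Phi>. l \<phi> * \<i> * of_real (Im (exp_mod (\<phi> u) ^ Suc n) / real (Suc n)))
        = (\<lambda>n. a (m * Suc n) / of_nat (Suc n))"
    proof
      fix n
      define z where "z \<phi> = exp_mod (\<phi> u) ^ Suc n" for \<phi>
      have Im: "\<i> * of_real (Im w) = (w - cnj w) / 2" for w by (simp add: complex_eq_iff)
      have "(\<Sum>\<phi>\<in>\<Phi>. l \<phi> * \<i> * of_real (Im (z \<phi>) / real (Suc n)))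
          = ((\<Sum>\<phi>\<in>\<Phi>. l \<phi> * z \<phi>) - (\<Sum>\<phi>\<in>\<Phi>. l \<phi> * cnj (z \<phi>))) / 2 / of_nat (Suc n)"
        unfolding of_real_divide mult.assoc times_divide_eq_right Im
        by (simp add: sum_subtractf[symmetric] sum_divide_distrib right_diff_distrib del: of_nat_Suc)
      also have "(\<Sum>\<phi>\<in>\<Phi>. l \<phi> * cnj (z \<phi>)) = - (\<Sum>\<phi>\<in>\<Phi>. l \<phi> * z \<phi>)"
        unfolding z_def complex_cnj_power by (rule cnj[OF u])
      also have "(\<Sum>\<phi>\<in>\<Phi>. l \<phi> * z \<phi>) = a (m * Suc n)"
        unfolding a_def z_def u_def
        by (intro sum.cong refl) (simp only: exp_mod_dual_pow g power_mult)
      finally show "(\<Sum>\<phi>\<in>\<Phi>. l \<phi> * \<i> * of_real (Im (exp_mod (\<phi> u) ^ Suc n) / real (Suc n)))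
          = a (m * Suc n) / of_nat (Suc n)" by (simp add: z_def del: of_nat_Suc)
    qed
    finally show "(\<lambda>n. a (m * Suc n) / of_nat (Suc n)) sums 0" .
  qed
  from L_null_imp_zero[OF order_pos this, of 1]
  show "(\<Sum>\<phi>\<in>\<Phi>. l \<phi> * exp_mod (\<phi> g)) = 0" by (simp add: a_def)
qed

lemma S_fun_odd:
  assumes "g \<in> carrier G"
  shows "S_fun G g \<in> L2_odd (dual_group G)"
  using assms by (auto simp: L2_odd_def S_fun_def inv_dual_apply B1_mod_inv dual_closed)

section \<open>Linear duality\<close>

lemma L2_odd_le_span: "L2_odd (dual_group G) \<subseteq> module.span fun_scale (S_fun G ` carrier G)"
proof
  interpret vs: vector_space "fun_scale :: complex \<Rightarrow> (('a \<Rightarrow> real set) \<Rightarrow> complex) \<Rightarrow> _"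
    by (rule vector_space_fun_scale)
  interpret c: vector_space "(*) :: complex \<Rightarrow> complex \<Rightarrow> complex"
    by unfold_locales (auto simp: algebra_simps)
  interpret p: vector_space_pair "fun_scale :: complex \<Rightarrow> (('a \<Rightarrow> real set) \<Rightarrow> complex) \<Rightarrow> _" "(*) :: complex \<Rightarrow> complex \<Rightarrow> complex" ..
  fix f assume f: "f \<in> L2_odd (dual_group G)"
  show "f \<in> vs.span (S_fun G ` carrier G)"
  proof (rule ccontr)
    assume nf: "f \<notin> vs.span (S_fun G ` carrier G)"
    \<comment> \<open>A basis of the span stays independent after adjoining \<open>f\<close>, so the
      values 0 on it and 1 at \<open>f\<close> extend to a linear functional.\<close>
    obtain B where B: "B \<subseteq> S_fun G ` carrier G" "vs.independent B" "S_fun G ` carrier G \<subseteq> vs.span B"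
      using vs.maximal_independent_subset by blast
    have nB: "f \<notin> vs.span B" using nf vs.span_mono[OF B(1)] by blast
    then have "vs.independent (insert f B)" using B(2) by (rule vs.independent_insertI)
    from p.linear_independent_extend[OF this, of "\<lambda>x. if x = f then 1 else 0"]
    obtain \<Lambda> where lin: "Vector_Spaces.linear fun_scale (*) \<Lambda>"
      and \<Lambda>: "\<And>x. x \<in> insert f B \<Longrightarrow> \<Lambda> x = (if x = f then 1 else 0)" by blast
    interpret \<Lambda>: Vector_Spaces.linear fun_scale "(*)" \<Lambda> by (rule lin)
    have "\<Lambda> x = 0" if "x \<in> B" for x using \<Lambda>[of x] that nB vs.span_base by auto
    then have \<Lambda>S: "\<Lambda> (S_fun G g) = 0" if "g \<in> carrier G" for g
      using \<Lambda>.eq_0_on_span[of B] B(3) that by blast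
    \<comment> \<open>Values of \<open>\<Lambda>\<close> on point masses represent it on all
      functions supported on the finite dual.\<close>
    define l where "l \<phi> = \<Lambda> (\<lambda>\<psi>. if \<psi> = \<phi> then 1 else 0)" for \<phi>
    have rep: "\<Lambda> k = (\<Sum>\<phi>\<in>\<Phi>. l \<phi> * k \<phi>)"
      if k: "\<And>\<phi>. \<phi> \<notin> \<Phi> \<Longrightarrow> k \<phi> = 0" for k
    proof -
      have app: "sum F A \<psi> = (\<Sum>\<phi>\<in>A. F \<phi> \<psi>)"
        for F :: "('a \<Rightarrow> real set) \<Rightarrow> ('a \<Rightarrow> real set) \<Rightarrow> complex" and A \<psi>
        by (induction A rule: infinite_finite_induct) auto
      have "k = (\<Sum>\<phi>\<in>\<Phi>. fun_scale (k \<phi>) (\<lambda>\<psi>. if \<psi> = \<phi> then 1 else 0))"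
      proof
        fix \<psi>
        have "(\<Sum>\<phi>\<in>\<Phi>. k \<phi> * (if \<psi> = \<phi> then 1 else 0))
            = (\<Sum>\<phi>\<in>\<Phi>. if \<psi> = \<phi> then k \<phi> else 0)"
          by (intro sum.cong) auto
        then show "k \<psi> = (\<Sum>\<phi>\<in>\<Phi>. fun_scale (k \<phi>) (\<lambda>\<psi>. if \<psi> = \<phi> then 1 else 0)) \<psi>"
          using k[of \<psi>] finite_dual by (simp add: app fun_scale_def)
      qed
      then have "\<Lambda> k = \<Lambda> (\<Sum>\<phi>\<in>\<Phi>. fun_scale (k \<phi>) (\<lambda>\<psi>. if \<psi> = \<phi> then 1 else 0))"
        by (rule arg_cong)
      then show ?thesis by (simp add: \<Lambda>.sum \<Lambda>.scale l_def mult.commute)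
    qed
    \<comment> \<open>\<open>\<Lambda>\<close> is an arbitrary extension, so \<open>l\<close> need
      not be odd. Antisymmetrising doubles the pairing with odd functions.\<close>
    define l' where "l' \<phi> = l \<phi> - l (dinv \<phi>)" for \<phi>
    have pair: "(\<Sum>\<phi>\<in>\<Phi>. l' \<phi> * k \<phi>) = 2 * \<Lambda> k" if k: "k \<in> L2_odd (dual_group G)" for k
    proof -
      have "(\<Sum>\<phi>\<in>\<Phi>. l (dinv \<phi>) * k \<phi>)
          = (\<Sum>\<phi>\<in>\<Phi>. - (l (dinv \<phi>) * k (dinv \<phi>)))"
        using k by (intro sum.cong) (auto simp: L2_odd_def)
      also have "\<dots> = - (\<Sum>\<phi>\<in>\<Phi>. l \<phi> * k \<phi>)"
        using sum_dual_inv[of "\<lambda>\<phi>. l \<phi> * k \<phi>"] by (simp add: sum_negf)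
      finally show ?thesis
        using rep[of k] k by (simp add: l'_def left_diff_distrib sum_subtractf L2_odd_def)
    qed
    have "l' \<phi> = 0" if "\<phi> \<in> \<Phi>" for \<phi>
    proof (rule odd_annihilator_zero[OF _ _ that])
      show "l' (dinv \<phi>) = - l' \<phi>" if "\<phi> \<in> \<Phi>" for \<phi>
        using that by (simp add: l'_def)
      show "(\<Sum>\<phi>\<in>\<Phi>. l' \<phi> * S_fun G g \<phi>) = 0" if "g \<in> carrier G" for g
        using pair[OF S_fun_odd[OF that]] \<Lambda>S[OF that] by simp
    qed
    then have "2 * \<Lambda> f = 0" using pair[OF f] by simp
    then show False using \<Lambda>[of f] by simp
  qed
qed

end

theorem theorem3p8:
  fixes G :: "('a, 'm) monoid_scheme"
  assumes "comm_group G" and "finite (carrier G)"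
  shows "module.span fun_scale (S_fun G ` carrier G) = L2_odd (dual_group G)"
proof
  interpret vs: vector_space "fun_scale :: complex \<Rightarrow> (('a \<Rightarrow> real set) \<Rightarrow> complex) \<Rightarrow> _"
    by (rule vector_space_fun_scale)
  show "vs.span (S_fun G ` carrier G) \<subseteq> L2_odd (dual_group G)"
    by (rule vs.span_minimal) (use S_fun_odd[OF assms] subspace_L2_odd in auto)
  show "L2_odd (dual_group G) \<subseteq> vs.span (S_fun G ` carrier G)"
    by (rule L2_odd_le_span[OF assms])
qed

end
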